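(* Let $H:\mathbb{R}\to[0,\infty)$ be a symmetric convex function such that $H(x)=\tfrac14 x^2$ for $x\in[-2t_0,2t_0]$ for some $t_0>0$, and let $H^*:\mathbb{R}\to[0,\infty)$ be its Fenchel--Legendre transform, $H^*(x)=\sup_{y\in\mathbb{R}}\{xy-H(y)\}$. Suppose moreover that $\lim_{x\to\infty}H^*(x)/x=\infty$ and that there exist $A\in[1,\infty)$ and $\alpha\in(1,2]$ such that $$H(sx)\le A s^{\alpha}H(x)\quad\text{for all } x\in\mathbb{R},\ s\in[0,1].$$ Denote $\theta(t)=H^*(t)$ for $t\ge 0$. For a Borel probability measure $\mu$ on $\mathbb{R}$ the following conditions are equivalent. (i) For every $s>0$ we have $\int_{\mathbb{R}}e^{s|x|}\,d\mu(x)<\infty$, and there exists $c>0$ such that $$\operatorname{Ent}_\mu(e^{\varphi})\le\int_{\mathbb{R}}H(c\varphi')e^{\varphi}\,d\mu$$ for every smooth convex Lipschitz function $\varphi:\mathbb{R}\to\mathbb{R}$. (ii) There exists $b>0$ such that for all $h>0$, $$\Delta_\mu(h)\le\frac1b\,\theta^{-1}(t_0^2+h).$$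
   Context: For a non-negative function $g$, $\operatorname{Ent}_\mu(g)=\int g\ln g\,d\mu-\int g\,d\mu\,\ln\bigl(\int g\,d\mu\bigr)$ if $\int g\ln g\,d\mu<\infty$, and $\operatorname{Ent}_\mu(g)=\infty$ otherwise. Let $\tau$ be the symmetric exponential probability measure on $\mathbb{R}$ with density $\tfrac12e^{-|x|}$, $F_\tau$ its distribution function, $F_\mu(x)=\mu((-\infty,x])$, and $F_\mu^{-1}(t)=\inf\{y\in\mathbb{R}:F_\mu(y)\ge t\}\in\mathbb{R}\cup\{\pm\infty\}$ for $t\in[0,1]$. Let $U_\mu=F_\mu^{-1}\circ F_\tau$, i.e. $U_\mu(x)=F_\mu^{-1}(\tfrac12e^{-|x|})$ for $x<0$ and $U_\mu(x)=F_\mu^{-1}(1-\tfrac12e^{-|x|})$ for $x\ge0$ (the unique left-continuous non-decreasing map transporting $\tau$ onto $\mu$). For $h>0$, $\Delta_\mu(h)=\sup_{x\in\mathbb{R}}\{U_\mu(x+h)-U_\mu(x)\}$. $\theta^{-1}$ denotes the inverse of the increasing function $\theta$ on $[0,\infty)$. *)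

theory Defs
  imports "HOL-Probability.Probability"
begin

text \<open>Entropy: Ent_mu(g) = int g ln g - int g ln(int g) if int g ln g < infinity, else infinity.
  For g \<ge> 0 on a probability space, g ln g \<ge> -1/e, so "int g ln g < infinity" means integrability.\<close>
definition Ent :: "real measure \<Rightarrow> (real \<Rightarrow> real) \<Rightarrow> ereal" where
  "Ent \<mu> g = (if integrable \<mu> (\<lambda>x. g x * ln (g x))
     then ereal ((\<integral>x. g x * ln (g x) \<partial>\<mu>) - (\<integral>x. g x \<partial>\<mu>) * ln (\<integral>x. g x \<partial>\<mu>))
     else \<infinity>)"

definition legendre :: "(real \<Rightarrow> real) \<Rightarrow> real \<Rightarrow> real" where
  "legendre H x = (SUP y. x * y - H y)"

text \<open>Distribution function and generalized inverse (used only at t in (0,1), where it is finite).\<close>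
definition distr_fun :: "real measure \<Rightarrow> real \<Rightarrow> real" where
  "distr_fun \<mu> x = measure \<mu> {..x}"

definition quantile :: "real measure \<Rightarrow> real \<Rightarrow> real" where
  "quantile \<mu> t = Inf {y. distr_fun \<mu> y \<ge> t}"

definition F_tau :: "real \<Rightarrow> real" where
  "F_tau x = (if x < 0 then exp x / 2 else 1 - exp (- x) / 2)"

definition U_map :: "real measure \<Rightarrow> real \<Rightarrow> real" where
  "U_map \<mu> x = quantile \<mu> (F_tau x)"

definition Delta :: "real measure \<Rightarrow> real \<Rightarrow> ereal" where
  "Delta \<mu> h = (SUP x. ereal (U_map \<mu> (x + h) - U_map \<mu> x))"

definition smooth :: "(real \<Rightarrow> real) \<Rightarrow> bool" where
  "smooth f \<longleftrightarrow> (\<forall>k x. ((deriv ^^ k) f) differentiable (at x))"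

end

theory Submission
  imports Defs "HOL-Real_Asymp.Real_Asymp"
begin

text \<open>
  Write \<open>\<theta> = H\<^sup>*\<close> and \<open>U\<close> for the monotone map transporting the symmetric exponential law onto \<open>\<mu>\<close>.

  From the log-Sobolev inequality to the condition on \<open>U\<close>: test the inequality on the hinges
  \<open>\<lambda> (x - u)\<^sub>+\<close> and their reflections, where \<open>p = \<mu> (u, \<infinity>) \<le> 1/2\<close>. For the logarithm \<open>V(\<lambda>)\<close> of
  the exponential moment conditioned on \<open>(u, \<infinity>)\<close>, a two-point lower bound on the entropy bounds
  \<open>V\<close> for small \<open>\<lambda>\<close> independently of \<open>u\<close>, and Jensen's inequality gives the discrete Herbst step
  \<open>V(\<lambda>) \<le> 2 V(\<lambda>/2) + H(c\<lambda>)\<close>. Iterated, the growth condition on \<open>H\<close> turns it into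
  \<open>V(\<lambda>) \<le> C + K\<lambda> + A' H(c\<lambda>)\<close>, and Chernoff's bound yields
  \<open>\<mu> (u + r, \<infinity>) \<le> 6 p exp (- \<theta>((r - K)/(cA')))\<close>, which is the condition on \<open>U\<close>.

  Conversely, with \<open>a\<close> the value of \<open>\<phi>\<close> at the median \<open>U 0\<close> and \<open>\<psi>(x) = x e\<^sup>x - e\<^sup>x + 1\<close>, the
  entropy of \<open>e\<^sup>\<phi>\<close> is at most the integral of \<open>e\<^sup>a \<psi>(\<phi> - a)\<close>. Where \<open>\<phi> \<le> a\<close>, convexity compares
  it with the slope at the median. Where \<open>\<phi> > a\<close>, the increments of \<open>F = (\<phi> \<circ> U - a)\<^sub>+\<close> over a
  step \<open>n\<close> are at most \<open>\<phi>'(U y) \<theta>\<^sup>-\<^sup>1(t\<^sub>0\<^sup>2 + n) / b\<close>. With \<open>n\<close> of order \<open>1 + H(c \<phi>'(U y))\<close>,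
  Young's inequality bounds the increment by \<open>n/2\<close>, so
  \<open>\<psi>(F y) \<le> C H(c \<phi>'(U y)) exp (F y) + exp (3n/4) \<psi>(F (y - n))\<close>; integrated against \<open>exp (- y)\<close>,
  the last terms form a small multiple of the left-hand side and are absorbed.
\<close>

section \<open>Even convex functions and their Legendre transforms\<close>

locale even_convex =
  fixes H :: "real \<Rightarrow> real"
  assumes H_nonneg: "0 \<le> H x"
    and H_even: "H (- x) = H x"
    and H_convex: "convex_on UNIV H"
    and H_0 [simp]: "H 0 = 0"
begin

lemma continuous_on_H: "continuous_on S H"
  using convex_on_continuous[OF open_UNIV H_convex] by (rule continuous_on_subset) simp

lemma borel_measurable_H [measurable]: "H \<in> borel_measurable borel"
  by (rule borel_measurable_continuous_onI[OF continuous_on_H])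

lemma H_abs [simp]: "H \<bar>x\<bar> = H x"
  using H_even[of x] by (simp add: abs_if)

lemma H_contract:
  assumes "0 \<le> s" "s \<le> 1"
  shows "H (s * x) \<le> s * H x"
  using convex_onD[OF H_convex, of s 0 x] assms by simp

lemma H_scale:
  assumes "1 \<le> s"
  shows "s * H x \<le> H (s * x)"
  using H_contract[of "1 / s" "s * x"] assms by (simp add: field_simps)

lemma H_mono:
  assumes "\<bar>x\<bar> \<le> \<bar>y\<bar>"
  shows "H x \<le> H y"
proof (cases "y = 0")
  case False
  have "H (\<bar>x\<bar> / \<bar>y\<bar> * \<bar>y\<bar>) \<le> \<bar>x\<bar> / \<bar>y\<bar> * H \<bar>y\<bar>"
    by (rule H_contract) (use assms False in \<open>auto simp: field_simps\<close>)
  also have "\<dots> \<le> 1 * H \<bar>y\<bar>"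
    using assms False H_nonneg by (intro mult_right_mono) (auto simp: field_simps)
  finally show ?thesis using False by simp
qed (use assms in auto)

end

locale young_function = even_convex +
  assumes H_pos: "0 < x \<Longrightarrow> 0 < H x"
begin

abbreviation H_inv :: "real \<Rightarrow> real" where "H_inv \<equiv> the_inv_into {0..} H"

lemma H_strict_mono:
  assumes "0 \<le> x" "x < y"
  shows "H x < H y"
proof -
  have "H (x / y * y) \<le> x / y * H y"
    by (rule H_contract) (use assms in auto)
  also have "\<dots> < 1 * H y"
    using assms H_pos[of y] by (intro mult_strict_right_mono) auto
  finally show ?thesis using assms by simp
qed

lemma H_le_iff: "0 \<le> x \<Longrightarrow> 0 \<le> y \<Longrightarrow> H x \<le> H y \<longleftrightarrow> x \<le> y"
  by (metis H_strict_mono linorder_not_less order_le_less)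

lemma inj_on_H: "inj_on H {0..}"
  by (rule inj_onI) (metis atLeast_iff H_le_iff order_antisym order_refl)

lemma H_image_atLeast: "H ` {0..} = {0..}"
proof (intro equalityI subsetI)
  fix v :: real assume "v \<in> {0..}"
  define s where "s = max 1 (v / H 1)"
  have "v \<le> s * H 1" using H_pos[of 1] by (auto simp: s_def max_def field_simps)
  also have "\<dots> \<le> H s" using H_scale[of s 1] by (simp add: s_def)
  finally obtain r where "0 \<le> r" "H r = v"
    using IVT'[OF _ _ _ continuous_on_H, of 0 v s] \<open>v \<in> {0..}\<close> by (force simp: s_def)
  then show "v \<in> H ` {0..}" by auto
qed (use H_nonneg in auto)

lemma
  assumes "0 \<le> v"
  shows H_H_inv: "H (H_inv v) = v" and H_inv_nonneg: "0 \<le> H_inv v"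
  using f_the_inv_into_f[OF inj_on_H, of v] the_inv_into_into[OF inj_on_H, of v "{0..}"] assms
  by (auto simp: H_image_atLeast)

lemma H_inv_le:
  assumes "0 \<le> v" "0 \<le> r" "v \<le> H r"
  shows "H_inv v \<le> r"
  using assms H_le_iff[of "H_inv v" r] by (simp add: H_H_inv H_inv_nonneg)

lemma H_inv_mono: "0 \<le> v \<Longrightarrow> v \<le> w \<Longrightarrow> H_inv v \<le> H_inv w"
  by (rule H_inv_le) (auto simp: H_H_inv H_inv_nonneg)

lemma H_inv_pos: "0 < v \<Longrightarrow> 0 < H_inv v"
  using H_H_inv[of v] H_inv_nonneg[of v] by (metis H_0 order_less_le)

lemma H_inv_scale:
  assumes "1 \<le> s" "0 \<le> v"
  shows "H_inv (s * v) \<le> s * H_inv v"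
  using H_scale[OF assms(1), of "H_inv v"] assms
  by (intro H_inv_le) (auto simp: H_H_inv H_inv_nonneg)

end

locale finite_legendre = even_convex +
  assumes bdd_above_legendre: "bdd_above (range (\<lambda>y. x * y - H y))"
begin

abbreviation \<theta> :: "real \<Rightarrow> real" where "\<theta> \<equiv> legendre H"

lemma young: "x * y \<le> H y + \<theta> x"
  using cSUP_upper[OF UNIV_I bdd_above_legendre, of x y] by (simp add: legendre_def)

lemma legendre_leI: "(\<And>y. x * y - H y \<le> z) \<Longrightarrow> \<theta> x \<le> z"
  unfolding legendre_def by (rule cSUP_least) auto

lemma convex_on_legendre: "convex_on UNIV \<theta>"
proof (rule convex_onI)
  fix t x y :: real assume t: "0 < t" "t < 1"
  show "\<theta> ((1 - t) *\<^sub>R x + t *\<^sub>R y) \<le> (1 - t) * \<theta> x + t * \<theta> y"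
  proof (rule legendre_leI)
    fix z
    have "((1 - t) *\<^sub>R x + t *\<^sub>R y) * z - H z = (1 - t) * (x * z - H z) + t * (y * z - H z)"
      by (simp add: algebra_simps)
    also have "\<dots> \<le> (1 - t) * \<theta> x + t * \<theta> y"
      using t young[of x z] young[of y z] by (intro add_mono mult_left_mono) auto
    finally show "((1 - t) *\<^sub>R x + t *\<^sub>R y) * z - H z \<le> (1 - t) * \<theta> x + t * \<theta> y" .
  qed
qed simp

lemma even_convex_legendre: "even_convex \<theta>"
proof
  show "0 \<le> \<theta> x" for x using young[of x 0] by simp
  show "\<theta> (- x) = \<theta> x" for x
  proof (rule antisym; rule legendre_leI)
    show "- x * y - H y \<le> \<theta> x" for y using young[of x "- y"] H_even[of y] by simp
    show "x * y - H y \<le> \<theta> (- x)" for y using young[of "- x" "- y"] H_even[of y] by simp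
  qed
  show "\<theta> 0 = 0" using young[of 0 0] legendre_leI[of 0 0] H_nonneg by (auto intro: antisym)
qed (rule convex_on_legendre)

lemma chernoff_legendre:
  assumes P: "0 \<le> P" "P \<le> Q" and "0 \<le> x"
    and bound: "\<And>y. 0 < y \<Longrightarrow> P \<le> Q * exp (- (x * y - H y))"
  shows "P \<le> Q * exp (- \<theta> x)"
proof (cases "P = 0")
  case False
  then have "0 < P" "0 < Q" using P by auto
  have "x * y - H y \<le> ln (Q / P)" for y
  proof (cases "0 < y")
    case True
    have "exp (x * y - H y) \<le> Q / P"
      using bound[OF True] \<open>0 < P\<close> by (simp add: exp_diff field_simps)
    then show ?thesis using \<open>0 < P\<close> \<open>0 < Q\<close> by (simp add: ln_ge_iff)
  next
    case False
    then have "x * y - H y \<le> 0"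
      using \<open>0 \<le> x\<close> H_nonneg[of y] mult_nonneg_nonpos[of x y] by linarith
    also have "0 \<le> ln (Q / P)" using P \<open>0 < P\<close> by simp
    finally show ?thesis .
  qed
  then have "\<theta> x \<le> ln (Q / P)" by (rule legendre_leI)
  then show ?thesis using \<open>0 < P\<close> \<open>0 < Q\<close> by (simp add: ln_ge_iff exp_minus field_simps)
qed (use P in simp)

end

locale young_cost = even_convex +
  fixes t0 A \<alpha> :: real
  assumes t0_pos: "0 < t0"
    and H_quad: "\<bar>x\<bar> \<le> 2 * t0 \<Longrightarrow> H x = x\<^sup>2 / 4"
    and A_ge: "1 \<le> A"
    and alpha_gt: "1 < \<alpha>"
    and H_growth: "0 \<le> s \<Longrightarrow> s \<le> 1 \<Longrightarrow> H (s * x) \<le> A * s powr \<alpha> * H x"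
begin

lemma H_ge_t0:
  assumes "2 * t0 \<le> \<bar>x\<bar>"
  shows "t0\<^sup>2 \<le> H x"
  using H_mono[of "2 * t0" x] H_quad[of "2 * t0"] assms t0_pos by (simp add: power2_eq_square)

lemma H_ge_powr:
  assumes "2 * t0 \<le> y"
  shows "t0\<^sup>2 / A * (y / (2 * t0)) powr \<alpha> \<le> H y"
proof -
  have "t0\<^sup>2 = H (2 * t0 / y * y)"
    using assms H_quad[of "2 * t0"] t0_pos by (simp add: power2_eq_square)
  also have "\<dots> \<le> A * (2 * t0 / y) powr \<alpha> * H y"
    using assms t0_pos by (intro H_growth) (auto simp: field_simps)
  finally show ?thesis
    using assms t0_pos A_ge by (simp add: powr_divide field_simps)
qed

lemma eventually_H_ge_linear: "eventually (\<lambda>y. x * y \<le> H y) at_top"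
proof -
  define q where "q = max 1 x"
  define r where "r = t0\<^sup>2 / A"
  have "0 < q" "0 < r" using t0_pos A_ge by (auto simp: q_def r_def)
  then have "eventually (\<lambda>y. q * y \<le> r * (y / (2 * t0)) powr \<alpha>) at_top"
    using t0_pos alpha_gt by real_asymp
  then show ?thesis using eventually_ge_at_top[of "2 * t0"]
  proof eventually_elim
    case (elim y)
    have "x * y \<le> q * y" using elim(2) t0_pos by (intro mult_right_mono) (auto simp: q_def)
    also have "\<dots> \<le> r * (y / (2 * t0)) powr \<alpha>" by (rule elim(1))
    also have "\<dots> \<le> H y" unfolding r_def by (rule H_ge_powr[OF elim(2)])
    finally show ?case .
  qed
qed

sublocale finite_legendre H
proof
  fix x
  obtain R where R: "0 \<le> R" "\<And>y. R \<le> y \<Longrightarrow> \<bar>x\<bar> * y \<le> H y"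
    using eventually_conj[OF eventually_H_ge_linear[of "\<bar>x\<bar>"] eventually_ge_at_top[of 0]]
    unfolding eventually_at_top_linorder by (metis linorder_le_cases order_refl order_trans)
  have "x * y - H y \<le> \<bar>x\<bar> * R" for y
  proof -
    have "x * y \<le> \<bar>x\<bar> * \<bar>y\<bar>" using abs_ge_self[of "x * y"] by (simp add: abs_mult)
    moreover have "\<bar>x\<bar> * \<bar>y\<bar> - H y \<le> \<bar>x\<bar> * R"
    proof (cases "R \<le> \<bar>y\<bar>")
      case True
      then have "\<bar>x\<bar> * \<bar>y\<bar> \<le> H y" using R(2)[of "\<bar>y\<bar>"] by simp
      moreover have "0 \<le> \<bar>x\<bar> * R" using R(1) by simp
      ultimately show ?thesis by linarith
    next
      case False
      then have "\<bar>x\<bar> * \<bar>y\<bar> \<le> \<bar>x\<bar> * R" by (intro mult_left_mono) auto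
      then show ?thesis using H_nonneg[of y] by linarith
    qed
    ultimately show ?thesis by linarith
  qed
  then show "bdd_above (range (\<lambda>y. x * y - H y))" by (intro bdd_aboveI2)
qed

lemma legendre_pos:
  assumes "0 < x"
  shows "0 < \<theta> x"
proof -
  define y where "y = min (2 * t0) x"
  have y: "0 < y" "y \<le> 2 * t0" "y \<le> x" using assms t0_pos by (auto simp: y_def)
  have "y\<^sup>2 / 4 < x * y"
    using y mult_right_mono[of y x y] by (simp add: power2_eq_square)
  then show ?thesis using young[of x y] H_quad[of y] y by simp
qed

sublocale dual: young_function \<theta>
  by (intro young_function.intro even_convex_legendre young_function_axioms.intro legendre_pos)

definition modulus :: "real \<Rightarrow> real" where
  "modulus h = the_inv_into {0..} \<theta> (t0\<^sup>2 + h)"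

lemma modulus_nonneg: "0 \<le> h \<Longrightarrow> 0 \<le> modulus h"
  unfolding modulus_def by (rule dual.H_inv_nonneg) simp

lemma modulus_mono: "0 \<le> h \<Longrightarrow> h \<le> h' \<Longrightarrow> modulus h \<le> modulus h'"
  unfolding modulus_def by (rule dual.H_inv_mono) auto

lemma mult_modulus_le:
  assumes "0 < e" "e \<le> 1" "0 \<le> h"
  shows "k * modulus h \<le> H (k / e) + e * (t0\<^sup>2 + h)"
proof -
  have "k * modulus h = (e * modulus h) * (k / e)" using assms by simp
  also have "\<dots> \<le> H (k / e) + \<theta> (e * modulus h)" by (rule young)
  also have "\<theta> (e * modulus h) \<le> e * \<theta> (modulus h)"
    using assms by (intro dual.H_contract) auto
  also have "\<theta> (modulus h) = t0\<^sup>2 + h"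
    unfolding modulus_def using assms by (intro dual.H_H_inv) auto
  finally show ?thesis by simp
qed

lemma affine_legendre_inv_le_modulus:
  assumes K: "0 \<le> K" and a: "0 < a" and w: "0 \<le> w"
  shows "\<exists>b>0. \<forall>h\<ge>0. K + a * dual.H_inv (h + w) \<le> modulus h / b"
proof -
  define \<eta> where "\<eta> = max 1 (w / t0\<^sup>2)"
  define D where "D = K / modulus 0 + a * \<eta>"
  have mod0: "0 < modulus 0" unfolding modulus_def using t0_pos by (intro dual.H_inv_pos) simp
  have \<eta>: "1 \<le> \<eta>" "w \<le> \<eta> * t0\<^sup>2" using t0_pos by (auto simp: \<eta>_def max_def field_simps)
  have D: "0 < D" unfolding D_def using K a mod0 \<eta> by (intro add_nonneg_pos) auto
  have "K + a * dual.H_inv (h + w) \<le> modulus h * D" if h: "0 \<le> h" for h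
  proof -
    have "K / modulus 0 * modulus 0 \<le> K / modulus 0 * modulus h"
      using K mod0 h by (intro mult_left_mono modulus_mono) auto
    then have "K \<le> K / modulus 0 * modulus h" using mod0 by simp
    moreover have "dual.H_inv (h + w) \<le> \<eta> * modulus h"
    proof -
      have "h + w \<le> \<eta> * (t0\<^sup>2 + h)"
        using \<eta> mult_right_mono[of 1 \<eta> h] h by (simp add: algebra_simps)
      then have "dual.H_inv (h + w) \<le> dual.H_inv (\<eta> * (t0\<^sup>2 + h))"
        using h w by (intro dual.H_inv_mono) auto
      also have "\<dots> \<le> \<eta> * modulus h"
        unfolding modulus_def using \<eta> h by (intro dual.H_inv_scale) auto
      finally show ?thesis .
    qed
    ultimately have "K + a * dual.H_inv (h + w) \<le> K / modulus 0 * modulus h + a * (\<eta> * modulus h)"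
      using a by (intro add_mono mult_left_mono) auto
    then show ?thesis by (simp add: D_def algebra_simps)
  qed
  then show ?thesis using D by (intro exI[of _ "1 / D"]) auto
qed

end

section \<open>A Hardy-type inequality for the exponential law\<close>

definition psi :: "real \<Rightarrow> real" where
  "psi x = x * exp x - exp x + 1"

lemma psi_0 [simp]: "psi 0 = 0"
  by (simp add: psi_def)

lemma borel_measurable_psi [measurable]: "psi \<in> borel_measurable borel"
  unfolding psi_def by measurable

lemma has_real_derivative_psi: "(psi has_real_derivative x * exp x) (at x)"
  unfolding psi_def [abs_def] by (auto intro!: derivative_eq_intros simp: algebra_simps)

lemma psi_mono:
  assumes "0 \<le> x" "x \<le> y"
  shows "psi x \<le> psi y"
  by (rule DERIV_nonneg_imp_nondecreasing[OF assms(2)])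
     (use has_real_derivative_psi assms in \<open>force intro!: mult_nonneg_nonneg\<close>)

lemma psi_nonneg: "0 \<le> psi x"
proof -
  have "(1 + - x) * exp x \<le> exp (- x) * exp x"
    by (intro mult_right_mono exp_ge_add_one_self) auto
  then show ?thesis by (simp add: psi_def algebra_simps flip: exp_add)
qed

lemma psi_ge_square:
  assumes "0 \<le> x"
  shows "x\<^sup>2 / 2 \<le> psi x"
proof -
  have "psi 0 - 0\<^sup>2 / 2 \<le> psi x - x\<^sup>2 / 2"
  proof (rule DERIV_nonneg_imp_nondecreasing[OF assms])
    fix y :: real assume "0 \<le> y"
    then have "0 \<le> y * exp y - y"
      using mult_left_mono[of 1 "exp y" y] by simp
    then show "\<exists>d. ((\<lambda>x. psi x - x\<^sup>2 / 2) has_real_derivative d) (at y) \<and> 0 \<le> d"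
      by (intro exI[of _ "y * exp y - y"])
         (auto intro!: derivative_eq_intros has_real_derivative_psi)
  qed
  then show ?thesis by simp
qed

lemma psi_ge_mult_exp:
  assumes "1 \<le> x"
  shows "x * exp x / 4 \<le> psi x"
proof (cases "4 / 3 \<le> x")
  case True
  then have "x / 4 * exp x \<le> (x - 1) * exp x" by (intro mult_right_mono) auto
  then show ?thesis by (simp add: psi_def algebra_simps)
next
  case False
  have "exp (4 / 3 :: real) ^ 3 = exp 1 ^ 4"
    by (simp flip: exp_of_nat_mult)
  also have "\<dots> \<le> (2.8 :: real) ^ 4"
    using e_less_272 by (intro power_mono) auto
  also have "\<dots> \<le> 4 ^ 3" by (simp add: power_divide)
  finally have "exp (4 / 3 :: real) \<le> 4"
    by (rule power_le_imp_le_base[of _ 2, simplified numeral_3_eq_3[symmetric] numeral_2_eq_2]) simp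
  moreover have "exp x \<le> exp (4 / 3)" using False by simp
  ultimately have "exp x \<le> 4" by linarith
  then have "(1 - 3 / 4 * x) * exp x \<le> 1 / 4 * 4"
    using assms False by (intro mult_mono) auto
  then show ?thesis by (simp add: psi_def algebra_simps)
qed

lemma psi_le_mult_exp: "0 \<le> x \<Longrightarrow> psi x \<le> x * exp x"
  by (simp add: psi_def)

lemma psi_le_square_exp:
  assumes "0 \<le> x"
  shows "psi x \<le> x\<^sup>2 * exp x"
proof -
  have "1 \<le> (x\<^sup>2 - x + 1) * (1 + x)"
    using assms by (simp add: algebra_simps power2_eq_square)
  also have "\<dots> \<le> (x\<^sup>2 - x + 1) * exp x"
    using zero_le_power2[of "x - 1/2"]
    by (intro mult_left_mono) (auto simp: power2_eq_square algebra_simps)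
  finally show ?thesis by (simp add: psi_def algebra_simps)
qed

lemma psi_le_one: "x \<le> 0 \<Longrightarrow> psi x \<le> 1"
  using mult_nonneg_nonneg[of "1 - x" "exp x"] by (simp add: psi_def algebra_simps)

lemma psi_le_square:
  assumes "x \<le> 0"
  shows "psi x \<le> x\<^sup>2"
proof -
  have "(1 - x) * (1 + x) \<le> (1 - x) * exp x"
    using assms by (intro mult_left_mono exp_ge_add_one_self) auto
  then show ?thesis by (simp add: psi_def algebra_simps power2_eq_square)
qed

lemma exp_ge_affine:
  fixes m :: real
  assumes "20 \<le> m"
  shows "4 * (1 + 2 * m) \<le> exp m"
proof -
  have "20 * m \<le> m\<^sup>2" unfolding power2_eq_square using assms by (intro mult_right_mono) auto
  moreover have "1 + m + m\<^sup>2 / 2 \<le> exp m" using assms by (intro exp_lower_Taylor_quadratic) auto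
  ultimately show ?thesis using assms by (simp add: field_simps)
qed

lemma psi_add_le:
  assumes "0 \<le> d" "d \<le> x" "d \<le> n / 2" "80 \<le> n"
  shows "psi (x + d) \<le> exp (3 * n / 4) * psi x"
proof (cases "1 \<le> x")
  case False
  have "exp (2 :: real) = exp 1 ^ 2" by (simp flip: exp_of_nat_mult)
  also have "\<dots> \<le> 2.72 ^ 2" using e_less_272 by (intro power_mono) auto
  finally have exp_2: "exp (2 :: real) \<le> 2.72 ^ 2" .
  have "psi (x + d) \<le> psi (2 * x)" by (rule psi_mono) (use assms in auto)
  also have "\<dots> \<le> (2 * x)\<^sup>2 * exp (2 * x)" by (rule psi_le_square_exp) (use assms in auto)
  also have "\<dots> \<le> (2 * x)\<^sup>2 * 2.72 ^ 2"
    using False by (intro mult_left_mono order_trans[OF _ exp_2]) auto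
  also have "\<dots> \<le> 60 * (x\<^sup>2 / 2)" by (simp add: power2_eq_square)
  also have "\<dots> \<le> exp (3 * n / 4) * psi x"
  proof (intro mult_mono psi_ge_square)
    show "60 \<le> exp (3 * n / 4)"
      using exp_ge_add_one_self[of "3 * n / 4"] assms by linarith
  qed (use assms in auto)
  finally show ?thesis .
next
  case True
  have n: "0 \<le> n" using assms by simp
  have "psi (x + d) \<le> psi (x + n / 2)" by (rule psi_mono) (use assms in auto)
  also have "\<dots> \<le> (x + n / 2) * exp (x + n / 2)"
    by (rule psi_le_mult_exp) (use assms in auto)
  also have "\<dots> \<le> (x * (1 + n / 2)) * exp (x + n / 2)"
    using True n mult_right_mono[of 1 x "n / 2"]
    by (intro mult_right_mono) (auto simp: algebra_simps)
  also have "\<dots> = (4 * (1 + n / 2)) * exp (n / 2) * (x * exp x / 4)"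
    by (simp add: exp_add)
  also have "\<dots> \<le> exp (n / 4) * exp (n / 2) * psi x"
    using exp_ge_affine[of "n / 4"] assms psi_ge_mult_exp[OF True] True n by (intro mult_mono) auto
  also have "exp (n / 4) * exp (n / 2) = exp (3 * n / 4)"
    by (simp flip: exp_add)
  finally show ?thesis .
qed

context young_cost
begin

text \<open>The factor \<open>16\<close> makes Young's inequality with weight \<open>1/8\<close> bound the increment over a step by
  half its length; \<open>80\<close> is what \<open>psi_add_le\<close> requires.\<close>

definition base_step :: nat where
  "base_step = nat \<lceil>max 80 (t0\<^sup>2)\<rceil>"

definition step_length :: "real \<Rightarrow> nat" where
  "step_length k = nat \<lceil>real base_step + 16 * H (8 * k)\<rceil>"

definition hardy_const :: real where
  "hardy_const =
    max ((modulus (real base_step + 16 * t0\<^sup>2 + 1))\<^sup>2 / 4) ((real base_step + 1) / t0\<^sup>2 + 16)"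

lemma base_step_ge: "80 \<le> real base_step" "t0\<^sup>2 \<le> real base_step"
  unfolding base_step_def by linarith+

lemma step_length_bounds:
  "real base_step + 16 * H (8 * k) \<le> real (step_length k)"
  "real (step_length k) \<le> real base_step + 16 * H (8 * k) + 1"
  unfolding step_length_def using H_nonneg[of "8 * k"] by linarith+

lemma base_step_le_step_length: "base_step \<le> step_length k"
  using step_length_bounds(1)[of k] H_nonneg[of "8 * k"] by linarith

lemma hardy_const_pos: "0 < hardy_const"
  unfolding hardy_const_def using t0_pos by (auto simp: less_max_iff_disj intro!: add_nonneg_pos)

lemma mult_modulus_step_le: "k * modulus (real (step_length k)) \<le> real (step_length k) / 2"
proof -
  have "k * modulus (real (step_length k)) \<le>
      H (k / (1 / 8)) + 1 / 8 * (t0\<^sup>2 + real (step_length k))"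
    by (rule mult_modulus_le) auto
  moreover have "H (k / (1 / 8)) = H (8 * k)" by (simp add: mult.commute)
  ultimately show ?thesis
    using step_length_bounds(1)[of k] base_step_ge H_nonneg[of "8 * k"] by argo
qed

lemma psi_le_cost:
  assumes k: "0 \<le> k" and v: "0 \<le> v" "v \<le> 2 * (k * modulus (real (step_length k)))"
  shows "psi v \<le> hardy_const * H (8 * k) * exp v"
proof (cases "8 * k \<le> 2 * t0")
  case True
  define D where "D = modulus (real base_step + 16 * t0\<^sup>2 + 1)"
  have H_eq: "H (8 * k) = 16 * k\<^sup>2" using True k by (simp add: H_quad power2_eq_square)
  have "(8 * k)\<^sup>2 \<le> (2 * t0)\<^sup>2" using True k by (intro power_mono) auto
  then have "real (step_length k) \<le> real base_step + 16 * t0\<^sup>2 + 1"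
    using step_length_bounds(2)[of k] unfolding H_eq power_mult_distrib by simp
  then have "k * modulus (real (step_length k)) \<le> k * D"
    unfolding D_def using k by (intro mult_left_mono modulus_mono) auto
  then have "v \<le> 2 * (k * D)" using v(2) by linarith
  then have "v\<^sup>2 \<le> (2 * (k * D))\<^sup>2" using v by (intro power_mono)
  also have "\<dots> = D\<^sup>2 / 4 * H (8 * k)" by (simp add: H_eq power_mult_distrib)
  also have "\<dots> \<le> hardy_const * H (8 * k)"
    using H_nonneg by (intro mult_right_mono) (auto simp: hardy_const_def D_def)
  finally have "v\<^sup>2 * exp v \<le> hardy_const * H (8 * k) * exp v" by (intro mult_right_mono) auto
  then show ?thesis using psi_le_square_exp[OF v(1)] by linarith
next
  case False
  then have "t0\<^sup>2 \<le> H (8 * k)" using k by (intro H_ge_t0) auto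
  then have "(real base_step + 1) / t0\<^sup>2 * t0\<^sup>2 \<le> (real base_step + 1) / t0\<^sup>2 * H (8 * k)"
    by (intro mult_left_mono) auto
  then have "real base_step + 1 \<le> (real base_step + 1) / t0\<^sup>2 * H (8 * k)" using t0_pos by simp
  then have "v \<le> ((real base_step + 1) / t0\<^sup>2 + 16) * H (8 * k)"
    using v mult_modulus_step_le[of k] step_length_bounds(2)[of k] by (simp add: algebra_simps)
  also have "\<dots> \<le> hardy_const * H (8 * k)"
    using H_nonneg by (intro mult_right_mono) (auto simp: hardy_const_def)
  finally have "v * exp v \<le> hardy_const * H (8 * k) * exp v" by (intro mult_right_mono) auto
  then show ?thesis using psi_le_mult_exp[OF v(1)] by linarith
qed

lemma psi_increment:
  assumes "0 \<le> k" "0 \<le> u" "0 \<le> v" and "v \<le> u + k * modulus (real (step_length k))"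
  shows "psi v \<le> hardy_const * H (8 * k) * exp v + exp (3 * real (step_length k) / 4) * psi u"
proof (cases "k * modulus (real (step_length k)) \<le> u")
  case True
  have "psi v \<le> psi (u + k * modulus (real (step_length k)))" using assms by (intro psi_mono) auto
  also have "\<dots> \<le> exp (3 * real (step_length k) / 4) * psi u"
    using assms True mult_modulus_step_le base_step_ge(1) base_step_le_step_length[of k]
    by (intro psi_add_le) (auto simp: modulus_nonneg)
  also have "\<dots> \<le> hardy_const * H (8 * k) * exp v + \<dots>"
    using hardy_const_pos H_nonneg by simp
  finally show ?thesis .
next
  case False
  then have "psi v \<le> hardy_const * H (8 * k) * exp v"
    using assms by (intro psi_le_cost) auto
  also have "\<dots> \<le> \<dots> + exp (3 * real (step_length k) / 4) * psi u"
    using psi_nonneg by simp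
  finally show ?thesis .
qed

end

definition std_exponential :: "real measure" where
  "std_exponential = density lborel (exponential_density 1)"

lemma sets_std_exponential [simp, measurable_cong]: "sets std_exponential = sets borel"
  by (simp add: std_exponential_def)

lemma space_std_exponential [simp]: "space std_exponential = UNIV"
  by (simp add: std_exponential_def)

interpretation std_exponential: prob_space std_exponential
  unfolding std_exponential_def by (rule prob_space_exponential_density) simp

lemma nn_integral_std_exponential:
  assumes [measurable]: "g \<in> borel_measurable borel"
  shows "(\<integral>\<^sup>+y. g y \<partial>std_exponential) =
    (\<integral>\<^sup>+y. ennreal (exp (- y)) * indicator {0..} y * g y \<partial>lborel)"
proof -
  have "ennreal (exponential_density 1 y) = ennreal (exp (- y)) * indicator {0..} y" for y
    by (auto simp: exponential_density_def indicator_def)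
  then show ?thesis
    unfolding std_exponential_def by (simp add: nn_integral_density)
qed

lemma AE_std_exponential_pos: "AE y in std_exponential. 0 < y"
  unfolding std_exponential_def
proof (subst AE_density)
  show "AE y in lborel. 0 < ennreal (exponential_density 1 y) \<longrightarrow> 0 < y"
    using AE_lborel_singleton[of 0] by eventually_elim (auto simp: exponential_density_def)
qed simp

lemma nn_integral_exp_std_exponential:
  assumes "r < 1"
  shows "(\<integral>\<^sup>+y. ennreal (exp (r * y)) \<partial>std_exponential) = ennreal (1 / (1 - r))"
proof -
  interpret scaled: prob_space "density lborel (exponential_density (1 - r))"
    by (rule prob_space_exponential_density) (use assms in simp)
  have "(\<integral>\<^sup>+y. ennreal (exp (r * y)) \<partial>std_exponential) =
      (\<integral>\<^sup>+y. ennreal (1 / (1 - r)) * ennreal (exponential_density (1 - r) y) \<partial>lborel)"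
  proof (subst nn_integral_std_exponential, measurable, intro nn_integral_cong)
    fix y :: real
    have "exp (- y) * exp (r * y) = exp (- (y * (1 - r)))"
      by (simp add: algebra_simps flip: exp_add)
    then show "ennreal (exp (- y)) * indicator {0..} y * ennreal (exp (r * y)) =
        ennreal (1 / (1 - r)) * ennreal (exponential_density (1 - r) y)"
      using assms by (auto simp: exponential_density_def indicator_def ennreal_mult[symmetric])
  qed
  also have "\<dots> = ennreal (1 / (1 - r))"
    using scaled.emeasure_space_1 by (subst nn_integral_cmult) (auto simp: emeasure_density)
  finally show ?thesis .
qed

lemma nn_integral_std_exponential_shift:
  assumes [measurable]: "g \<in> borel_measurable borel" and a: "0 \<le> a"
  shows "(\<integral>\<^sup>+y. indicator {a..} y * g (y - a) \<partial>std_exponential) =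
    ennreal (exp (- a)) * (\<integral>\<^sup>+y. g y \<partial>std_exponential)"
proof -
  have "(\<integral>\<^sup>+y. indicator {a..} y * g (y - a) \<partial>std_exponential) =
      (\<integral>\<^sup>+y. ennreal (exp (- y)) * indicator {a..} y * g (y - a) \<partial>lborel)"
    using a by (subst nn_integral_std_exponential, measurable, intro nn_integral_cong)
      (auto simp: indicator_def)
  also have "\<dots> = (\<integral>\<^sup>+y. ennreal (exp (- (a + y))) * indicator {a..} (a + y) * g y \<partial>lborel)"
    by (subst nn_integral_real_affine[where c = 1 and t = a]) auto
  also have "\<dots> =
      (\<integral>\<^sup>+y. ennreal (exp (- a)) * (ennreal (exp (- y)) * indicator {0..} y * g y) \<partial>lborel)"
    by (intro nn_integral_cong)
      (auto simp: indicator_def exp_diff exp_minus divide_inverse ennreal_mult mult.assoc)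
  also have "\<dots> = ennreal (exp (- a)) * (\<integral>\<^sup>+y. g y \<partial>std_exponential)"
    by (simp add: nn_integral_cmult nn_integral_std_exponential)
  finally show ?thesis .
qed

lemma ennreal_le_double_of_half_absorbed:
  fixes I J :: ennreal
  assumes "I < \<infinity>" and "I \<le> J + I / 2"
  shows "I \<le> 2 * J"
proof -
  have split: "I / 2 + I / 2 = I"
    by (simp add: ennreal_divide_times flip: mult_2_right)
  then have "I / 2 + I / 2 \<le> I / 2 + J" using assms(2) by (simp add: add.commute)
  moreover have "I / 2 \<noteq> top" using assms(1) by (simp add: ennreal_divide_eq_top_iff)
  ultimately have "I / 2 \<le> J" by (simp add: ennreal_add_left_cancel_le)
  then have "I / 2 + I / 2 \<le> J + J" by (intro add_mono)
  then show ?thesis by (simp add: split mult_2)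
qed

lemma suminf_exp_tail_le_half:
  assumes "80 \<le> real n0"
  shows "(\<Sum>m. ennreal (exp (- real (m + n0) / 4))) \<le> 1 / 2"
proof -
  define q where "q = exp (- 1 / 4 :: real)"
  have q: "0 < q" "q \<le> 4 / 5"
    using exp_ge_add_one_self[of "1 / 4 :: real"] by (auto simp: q_def exp_minus field_simps)
  have eq: "exp (- real (m + n0) / 4) = exp (- real n0 / 4) * q ^ m" for m
    by (simp add: q_def add_divide_distrib flip: exp_of_nat_mult exp_add)
  have sums: "(\<lambda>m. exp (- real (m + n0) / 4)) sums (exp (- real n0 / 4) * (1 / (1 - q)))"
    unfolding eq using q by (intro sums_mult geometric_sums) auto
  have "(\<Sum>m. ennreal (exp (- real (m + n0) / 4))) = ennreal (exp (- real n0 / 4) * (1 / (1 - q)))"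
    using sums by (intro suminf_ennreal_eq) auto
  also have "\<dots> \<le> ennreal (1 / 21 * 5)"
  proof (intro ennreal_leI mult_mono)
    show "exp (- real n0 / 4) \<le> 1 / 21"
      using exp_ge_add_one_self[of "real n0 / 4"] assms by (simp add: exp_minus field_simps)
    show "1 / (1 - q) \<le> 5" using q by (simp add: field_simps)
  qed (use q in auto)
  also have "\<dots> \<le> ennreal (1 / 2)" by (intro ennreal_leI) simp
  finally show ?thesis by (simp add: divide_ennreal_def)
qed

locale controlled_increments = young_cost +
  fixes F k :: "real \<Rightarrow> real"
  assumes F_measurable [measurable]: "F \<in> borel_measurable borel"
    and k_measurable [measurable]: "k \<in> borel_measurable borel"
    and F_nonneg: "0 \<le> F y"
    and k_nonneg: "0 \<le> k y"
    and F_0: "F 0 = 0"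
    and F_increment: "0 \<le> z \<Longrightarrow> z < y \<Longrightarrow> F y \<le> F z + k y * modulus (y - z)"
begin

lemma psi_F_le:
  assumes "0 < y"
  defines "n \<equiv> real (step_length (k y))"
  shows "psi (F y) \<le> hardy_const * H (8 * k y) * exp (F y) +
    indicator {n..} y * (exp (3 * n / 4) * psi (F (y - n)))"
proof (cases "n \<le> y")
  case True
  have "0 < n"
    using base_step_ge(1) base_step_le_step_length[of "k y"] by (simp add: n_def)
  then have "F y \<le> F (y - n) + k y * modulus n"
    using F_increment[of "y - n" y] True by simp
  then show ?thesis
    using psi_increment[OF k_nonneg F_nonneg F_nonneg] True by (simp add: n_def)
next
  case False
  have "F y \<le> k y * modulus y" using F_increment[of 0 y] assms(1) by (simp add: F_0)
  also have "\<dots> \<le> k y * modulus n"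
    using assms(1) False by (intro mult_left_mono modulus_mono k_nonneg) auto
  finally have "F y \<le> 0 + k y * modulus n" by simp
  then show ?thesis
    using psi_increment[OF k_nonneg order_refl F_nonneg] False by (simp add: n_def)
qed

lemma ennreal_psi_F_le:
  assumes "0 < y"
  shows "ennreal (psi (F y)) \<le> ennreal hardy_const * ennreal (H (8 * k y) * exp (F y)) +
    (\<Sum>m. ennreal (exp (3 * real (m + base_step) / 4)) *
      (indicator {real (m + base_step)..} y * ennreal (psi (F (y - real (m + base_step))))))"
    (is "_ \<le> ?cost + (\<Sum>m. ?g (real (m + base_step)))")
proof -
  define n where "n = step_length (k y)"
  have "ennreal (psi (F y)) \<le> ennreal (hardy_const * H (8 * k y) * exp (F y) +
      indicator {real n..} y * (exp (3 * real n / 4) * psi (F (y - real n))))"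
    unfolding n_def using psi_F_le[OF assms] by (rule ennreal_leI)
  also have "\<dots> = ?cost + ?g (real n)"
  proof (subst ennreal_plus)
    show "ennreal (hardy_const * H (8 * k y) * exp (F y)) +
        ennreal (indicator {real n..} y * (exp (3 * real n / 4) * psi (F (y - real n)))) =
        ?cost + ?g (real n)"
      using hardy_const_pos
      by (intro arg_cong2[where f = plus])
         (auto simp: indicator_def ennreal_mult' ennreal_mult'' H_nonneg psi_nonneg mult.assoc)
  qed (use hardy_const_pos in \<open>auto simp: H_nonneg psi_nonneg\<close>)
  also have "?g (real n) = ?g (real ((n - base_step) + base_step))"
    using base_step_le_step_length[of "k y"] by (simp add: n_def)
  also have "\<dots> \<le> (\<Sum>m. ?g (real (m + base_step)))"
    using sum_le_suminf[of "\<lambda>m. ?g (real (m + base_step))" "{n - base_step}"] by simp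
  finally show ?thesis by (simp add: add_left_mono)
qed

theorem hardy_inequality:
  assumes fin: "(\<integral>\<^sup>+y. ennreal (psi (F y)) \<partial>std_exponential) < \<infinity>"
  shows "(\<integral>\<^sup>+y. ennreal (psi (F y)) \<partial>std_exponential) \<le>
    2 * (ennreal hardy_const * (\<integral>\<^sup>+y. ennreal (H (8 * k y) * exp (F y)) \<partial>std_exponential))"
    (is "?I \<le> 2 * (_ * ?J)")
proof (rule ennreal_le_double_of_half_absorbed[OF fin])
  let ?g = "\<lambda>a y. ennreal (exp (3 * a / 4)) * (indicator {a..} y * ennreal (psi (F (y - a))))"
  have shift: "(\<integral>\<^sup>+y. ?g a y \<partial>std_exponential) = ennreal (exp (- a / 4)) * ?I" if "0 \<le> a" for a
  proof -
    have "(\<integral>\<^sup>+y. ?g a y \<partial>std_exponential) = ennreal (exp (3 * a / 4)) * (ennreal (exp (- a)) * ?I)"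
      using that
      by (subst nn_integral_cmult, measurable, subst nn_integral_std_exponential_shift) auto
    also have "\<dots> = ennreal (exp (3 * a / 4) * exp (- a)) * ?I"
      by (simp add: ennreal_mult mult.assoc)
    also have "exp (3 * a / 4) * exp (- a) = exp (- a / 4)" by (simp flip: exp_add)
    finally show ?thesis .
  qed
  have "?I \<le> (\<integral>\<^sup>+y. ennreal hardy_const * ennreal (H (8 * k y) * exp (F y)) +
      (\<Sum>m. ?g (real (m + base_step)) y) \<partial>std_exponential)"
    by (rule nn_integral_mono_AE[OF eventually_mono[OF AE_std_exponential_pos ennreal_psi_F_le]])
  also have "\<dots> =
      ennreal hardy_const * ?J + (\<Sum>m. \<integral>\<^sup>+y. ?g (real (m + base_step)) y \<partial>std_exponential)"
    by (subst nn_integral_add, measurable, subst nn_integral_cmult, measurable,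
        subst nn_integral_suminf, measurable)
  also have "(\<Sum>m. \<integral>\<^sup>+y. ?g (real (m + base_step)) y \<partial>std_exponential) =
      (\<Sum>m. ennreal (exp (- real (m + base_step) / 4)) * ?I)"
    by (subst shift) auto
  also have "(\<Sum>m. ennreal (exp (- real (m + base_step) / 4)) * ?I) =
      (\<Sum>m. ennreal (exp (- real (m + base_step) / 4))) * ?I"
    by (rule ennreal_suminf_multc)
  also have "\<dots> \<le> 1 / 2 * ?I"
    by (intro mult_right_mono suminf_exp_tail_le_half base_step_ge) auto
  finally show "?I \<le> ennreal hardy_const * ?J + ?I / 2"
    by (simp add: add_left_mono divide_ennreal_def mult.commute)
qed

end

section \<open>The Laplace law and the transport map\<close>

lemma F_tau_range: "0 < F_tau x" "F_tau x < 1"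
  by (auto simp: F_tau_def field_simps) (smt (verit) exp_less_one_iff exp_le_one_iff)+

lemma F_tau_nonpos: "x \<le> 0 \<Longrightarrow> F_tau x = exp x / 2"
  by (cases "x = 0") (auto simp: F_tau_def)

lemma F_tau_strict_mono:
  assumes "x < y"
  shows "F_tau x < F_tau y"
proof -
  have "exp x + exp (- y) < 1 + 1" if "x < 0" "\<not> y < 0"
    using that by (intro add_less_le_mono) auto
  then show ?thesis using assms by (auto simp: F_tau_def field_simps)
qed

lemma F_tau_le_iff: "F_tau x \<le> F_tau y \<longleftrightarrow> x \<le> y"
  by (metis F_tau_strict_mono linorder_not_less order_le_less)

lemma F_tau_surj:
  assumes "0 < q" "q < 1"
  obtains x where "F_tau x = q"
proof (cases "q < 1 / 2")
  case True
  then have "ln (2 * q) < 0" using assms by (simp add: ln_less_zero)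
  then show ?thesis using assms by (intro that[of "ln (2 * q)"]) (simp add: F_tau_def)
next
  case False
  then have "ln (2 * (1 - q)) \<le> 0" using assms by simp
  then show ?thesis
    using assms by (intro that[of "- ln (2 * (1 - q))"]) (simp add: F_tau_def field_simps)
qed

definition laplace :: "real measure" where
  "laplace = density lborel (\<lambda>x. ennreal (exp (- \<bar>x\<bar>) / 2))"

lemma sets_laplace [simp, measurable_cong]: "sets laplace = sets borel"
  by (simp add: laplace_def)

lemma space_laplace [simp]: "space laplace = UNIV"
  by (simp add: laplace_def)

lemma nn_integral_laplace:
  assumes [measurable]: "g \<in> borel_measurable borel"
  shows "2 * (\<integral>\<^sup>+x. g x \<partial>laplace) =
    (\<integral>\<^sup>+y. g y \<partial>std_exponential) + (\<integral>\<^sup>+y. g (- y) \<partial>std_exponential)"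
proof -
  let ?w = "\<lambda>x. ennreal (exp (- \<bar>x\<bar>))"
  have half: "2 * ennreal (exp (- \<bar>x\<bar>) / 2) = ?w x" for x
  proof -
    have "2 * ennreal (exp (- \<bar>x\<bar>) / 2) = ennreal (2 * (exp (- \<bar>x\<bar>) / 2))"
      by (subst ennreal_mult) auto
    then show ?thesis by simp
  qed
  have "2 * (\<integral>\<^sup>+x. g x \<partial>laplace) = (\<integral>\<^sup>+x. 2 * ennreal (exp (- \<bar>x\<bar>) / 2) * g x \<partial>lborel)"
    unfolding laplace_def by (simp add: nn_integral_density nn_integral_cmult mult.assoc)
  also have "\<dots> = (\<integral>\<^sup>+x. ?w x * indicator {0..} x * g x + ?w x * indicator {..<0} x * g x \<partial>lborel)"
    unfolding half by (intro nn_integral_cong) (auto simp: indicator_def)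
  also have "\<dots> = (\<integral>\<^sup>+x. ?w x * indicator {0..} x * g x \<partial>lborel) +
      (\<integral>\<^sup>+x. ?w x * indicator {..<0} x * g x \<partial>lborel)"
    by (rule nn_integral_add) measurable
  also have "(\<integral>\<^sup>+x. ?w x * indicator {0..} x * g x \<partial>lborel) = (\<integral>\<^sup>+y. g y \<partial>std_exponential)"
    unfolding nn_integral_std_exponential[OF assms]
    by (intro nn_integral_cong) (auto simp: indicator_def)
  also have "(\<integral>\<^sup>+x. ?w x * indicator {..<0} x * g x \<partial>lborel) =
      (\<integral>\<^sup>+x. ?w x * indicator {..<0} (- x) * g (- x) \<partial>lborel)"
    by (subst nn_integral_real_affine[where c = "-1" and t = 0]) auto
  also have "\<dots> = (\<integral>\<^sup>+y. g (- y) \<partial>std_exponential)"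
  proof (subst nn_integral_std_exponential, measurable, rule nn_integral_cong_AE)
    show "AE x in lborel. ?w x * indicator {..<0} (- x) * g (- x) =
        ennreal (exp (- x)) * indicator {0..} x * g (- x)"
      using AE_lborel_singleton[of 0] by eventually_elim (auto simp: indicator_def)
  qed
  finally show ?thesis .
qed

interpretation laplace: prob_space laplace
proof
  have "2 * emeasure laplace (space laplace) = 2 * 1"
    using nn_integral_laplace[of "\<lambda>_. 1"] std_exponential.emeasure_space_1 by simp
  then show "emeasure laplace (space laplace) = 1" by (simp only: ennreal_mult_cancel_left) simp
qed

lemma measure_laplace:
  assumes [measurable]: "S \<in> sets borel"
  shows "2 * measure laplace S = measure std_exponential S + measure std_exponential (uminus -` S)"
proof -
  have vimage [measurable]: "uminus -` S \<in> sets borel"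
    by (rule measurable_sets_borel[OF _ assms]) simp
  have "2 * emeasure laplace S =
      emeasure std_exponential S + emeasure std_exponential (uminus -` S)"
    using nn_integral_laplace[of "indicator S"]
    by (simp add: indicator_vimage[symmetric] vimage)
  then have "ennreal (2 * measure laplace S) =
      ennreal (measure std_exponential S + measure std_exponential (uminus -` S))"
    by (simp add: laplace.emeasure_eq_measure std_exponential.emeasure_eq_measure ennreal_mult)
  then show ?thesis by (subst (asm) ennreal_inj) (auto intro: add_nonneg_nonneg)
qed

lemma measure_std_exponential_atLeast:
  "measure std_exponential {a..} = exp (- max a 0)"
proof -
  have "AE y in std_exponential. y \<in> {a..} \<longleftrightarrow> y \<in> {max a 0..}"
    using AE_std_exponential_pos by eventually_elim auto
  then have "emeasure std_exponential {a..} = emeasure std_exponential {max a 0..}"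
    by (intro emeasure_eq_AE) auto
  also have "\<dots> = ennreal (exp (- max a 0))"
    using nn_integral_std_exponential_shift[of "\<lambda>_. 1" "max a 0"] std_exponential.emeasure_space_1
    by simp
  finally show ?thesis by (simp add: measure_def)
qed

lemma measure_std_exponential_atMost:
  "measure std_exponential {..a} = 1 - exp (- max a 0)"
proof -
  have "AE y in std_exponential. y \<noteq> a"
    unfolding std_exponential_def
    by (subst AE_density) (use AE_lborel_singleton[of a] in \<open>auto elim!: eventually_mono\<close>)
  then have "measure std_exponential {a<..} = measure std_exponential {a..}"
    by (intro std_exponential.finite_measure_eq_AE) (auto elim!: eventually_mono)
  moreover have "{..a} = space std_exponential - {a<..}" by auto
  ultimately show ?thesis
    using std_exponential.prob_compl[of "{a<..}"] by (simp add: measure_std_exponential_atLeast)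
qed

lemma measure_laplace_atMost: "measure laplace {..a} = F_tau a"
proof -
  have "uminus -` {..a} = {- a..}" by auto
  then have "2 * measure laplace {..a} = 1 - exp (- max a 0) + exp (- max (- a) 0)"
    using measure_laplace[of "{..a}"]
    by (simp add: measure_std_exponential_atMost measure_std_exponential_atLeast)
  then show ?thesis by (cases "a < 0") (auto simp: F_tau_def max_def)
qed

lemma measure_laplace_F_tau_le:
  assumes "0 \<le> q" "q \<le> 1"
  shows "measure laplace {x. F_tau x \<le> q} = q"
proof -
  consider (zero) "q = 0" | (one) "q = 1" | (between) "0 < q" "q < 1" using assms by linarith
  then show ?thesis
  proof cases
    case zero
    then have "{x. F_tau x \<le> q} = {}" using F_tau_range by (auto simp: not_le)
    then show ?thesis using zero by simp
  next
    case one
    then have "{x. F_tau x \<le> q} = space laplace" using F_tau_range by (auto intro: less_imp_le)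
    then show ?thesis using one laplace.prob_space by simp
  next
    case between
    then obtain z where z: "F_tau z = q" by (rule F_tau_surj)
    then have "{x. F_tau x \<le> q} = {..z}" by (auto simp: F_tau_le_iff simp flip: z)
    then show ?thesis using z by (simp add: measure_laplace_atMost)
  qed
qed

locale real_law = prob_space M for M :: "real measure" +
  assumes sets_M [simp, measurable_cong]: "sets M = sets borel"
begin

abbreviation U :: "real \<Rightarrow> real" where "U \<equiv> U_map M"

lemma space_M [simp]: "space M = UNIV"
  using sets_eq_imp_space_eq[OF sets_M] by simp

lemma prob_UNIV [simp]: "prob UNIV = 1"
  using prob_space by simp

sublocale real_distribution M
  by standard auto

lemma U_map_le_iff: "U x \<le> a \<longleftrightarrow> F_tau x \<le> prob {..a}"
proof -
  interpret cdf_distribution M by standard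
  show ?thesis
    using pseudoinverse[OF F_tau_range, of x a]
    by (simp add: U_map_def quantile_def distr_fun_def cdf_def)
qed

lemma U_map_mono: "x \<le> y \<Longrightarrow> U x \<le> U y"
  using U_map_le_iff[of y "U y"] F_tau_le_iff[of x y] by (simp add: U_map_le_iff)

lemma borel_measurable_U_map [measurable]: "U \<in> borel_measurable borel"
  by (intro borel_measurable_mono monoI U_map_mono)

lemma distr_laplace_U_map: "distr laplace borel U = M"
proof (rule cdf_unique)
  have [measurable]: "U \<in> measurable laplace borel"
    by (simp cong: measurable_cong_sets)
  show "real_distribution (distr laplace borel U)"
    by (intro laplace.real_distribution_distr) measurable
  show "cdf (distr laplace borel U) = cdf M"
    by (auto simp: cdf_def measure_distr vimage_def U_map_le_iff measure_laplace_F_tau_le)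
qed (rule real_distribution_axioms)

lemma nn_integral_U_map:
  assumes [measurable]: "g \<in> borel_measurable borel"
  shows "2 * (\<integral>\<^sup>+x. g x \<partial>M) =
    (\<integral>\<^sup>+y. g (U y) \<partial>std_exponential) + (\<integral>\<^sup>+y. g (U (- y)) \<partial>std_exponential)"
proof -
  have "(\<integral>\<^sup>+x. g x \<partial>M) = (\<integral>\<^sup>+x. g x \<partial>distr laplace borel U)"
    by (simp add: distr_laplace_U_map)
  also have "\<dots> = (\<integral>\<^sup>+x. g (U x) \<partial>laplace)"
    by (rule nn_integral_distr) (auto cong: measurable_cong_sets)
  finally show ?thesis by (simp add: nn_integral_laplace)
qed

lemma nn_integral_U_map_le:
  assumes "g \<in> borel_measurable borel" "\<bar>s\<bar> = 1"
  shows "(\<integral>\<^sup>+y. g (U (s * y)) \<partial>std_exponential) \<le> 2 * (\<integral>\<^sup>+x. g x \<partial>M)"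
proof -
  have "s = 1 \<or> s = - 1" using assms(2) by auto
  then show ?thesis
    unfolding nn_integral_U_map[OF assms(1)] by (auto intro: add_increasing add_increasing2)
qed

lemma nn_integral_le_of_U_map_le:
  assumes [measurable]: "f \<in> borel_measurable borel" "g \<in> borel_measurable borel"
    and le: "\<And>s. \<bar>s\<bar> = 1 \<Longrightarrow>
      (\<integral>\<^sup>+y. f (U (s * y)) \<partial>std_exponential) \<le> (\<integral>\<^sup>+y. g (U (s * y)) \<partial>std_exponential)"
  shows "(\<integral>\<^sup>+x. f x \<partial>M) \<le> (\<integral>\<^sup>+x. g x \<partial>M)"
proof -
  have "2 * (\<integral>\<^sup>+x. f x \<partial>M) \<le> 2 * (\<integral>\<^sup>+x. g x \<partial>M)"
    using le[of 1] le[of "- 1"] by (simp add: nn_integral_U_map add_mono)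
  then show ?thesis by (subst (asm) ennreal_mult_le_mult_iff) auto
qed

lemma U_map_le_of_tail:
  assumes "0 \<le> x" "prob {a<..} \<le> exp (- x) / 2"
  shows "U x \<le> a"
proof -
  have "{a<..} = space M - {..a}" by auto
  then have "F_tau x \<le> prob {..a}"
    using assms prob_compl[of "{..a}"] by (simp add: F_tau_def)
  then show ?thesis by (simp add: U_map_le_iff)
qed

lemma upper_tail_U_map:
  assumes "0 \<le> x"
  shows "prob {U x<..} \<le> exp (- x) / 2"
proof -
  have "F_tau x \<le> prob {..U x}" by (simp flip: U_map_le_iff)
  moreover have "{U x<..} = space M - {..U x}" by auto
  ultimately show ?thesis using assms prob_compl[of "{..U x}"] by (simp add: F_tau_def)
qed

lemma U_map_ge_of_tail:
  assumes "x \<le> 0" "prob {..<a} < exp x / 2"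
  shows "a \<le> U x"
proof (rule ccontr)
  assume "\<not> a \<le> U x"
  then have "prob {..U x} \<le> prob {..<a}" by (intro finite_measure_mono) auto
  moreover have "F_tau x \<le> prob {..U x}" by (simp flip: U_map_le_iff)
  ultimately show False using assms by (simp add: F_tau_nonpos)
qed

lemma lower_tail_U_map:
  assumes "x \<le> 0"
  shows "prob {..<U x} \<le> exp x / 2"
proof (rule tendsto_upperbound[OF cdf_at_left])
  have "cdf M z \<le> F_tau x" if "z < U x" for z
    using that U_map_le_iff[of x z] by (simp add: cdf_def)
  then show "eventually (\<lambda>z. cdf M z \<le> exp x / 2) (at_left (U x))"
    using assms by (auto simp: eventually_at_filter F_tau_nonpos)
qed simp

end

section \<open>Exponential moments and entropy\<close>

lemma exp_mult_le_exp_double: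
  fixes x :: real
  shows "\<bar>exp x * x\<bar> \<le> exp (2 * \<bar>x\<bar>)"
proof -
  have "\<bar>exp x * x\<bar> \<le> exp \<bar>x\<bar> * exp \<bar>x\<bar>"
    unfolding abs_mult
    using exp_ge_add_one_self[of "\<bar>x\<bar>"] by (intro mult_mono) (auto simp del: exp_ge_add_one_self)
  then show ?thesis by (simp flip: exp_add)
qed

lemma exp_le_of_linear_growth:
  fixes y :: real
  assumes "\<bar>y\<bar> \<le> K + L * \<bar>x\<bar>"
  shows "exp y \<le> exp K * exp (L * \<bar>x\<bar>)" "\<bar>exp y * y\<bar> \<le> exp (2 * K) * exp (2 * L * \<bar>x\<bar>)"
proof -
  show "exp y \<le> exp K * exp (L * \<bar>x\<bar>)" using assms by (simp flip: exp_add)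
  have "exp (2 * \<bar>y\<bar>) \<le> exp (2 * K) * exp (2 * L * \<bar>x\<bar>)" using assms by (simp flip: exp_add)
  then show "\<bar>exp y * y\<bar> \<le> exp (2 * K) * exp (2 * L * \<bar>x\<bar>)"
    using exp_mult_le_exp_double[of y] by linarith
qed

lemma mult_ln_ge_diff:
  fixes x y :: real
  assumes "0 < x" "0 < y"
  shows "x - y \<le> x * (ln x - ln y)"
proof -
  have "ln (y / x) \<le> y / x - 1" using assms by (intro ln_le_minus_one) auto
  then have "x * ln (y / x) \<le> x * (y / x - 1)" using assms by (intro mult_left_mono) auto
  then show ?thesis using assms by (simp add: ln_div algebra_simps)
qed

lemma Ent_exp:
  assumes "integrable M (\<lambda>x. exp (f x) * f x)"
  shows "Ent M (\<lambda>x. exp (f x)) =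
    ereal ((\<integral>x. exp (f x) * f x \<partial>M) - (\<integral>x. exp (f x) \<partial>M) * ln (\<integral>x. exp (f x) \<partial>M))"
  using assms by (simp add: Ent_def)

lemma (in prob_space) expectation_exp_pos:
  fixes f :: "'a \<Rightarrow> real"
  assumes "integrable M (\<lambda>x. exp (f x))"
  shows "0 < expectation (\<lambda>x. exp (f x))"
proof -
  have "expectation (\<lambda>x. exp (f x)) \<noteq> 0"
    using assms by (subst integral_nonneg_eq_0_iff_AE) (auto simp: AE_False)
  moreover have "0 \<le> expectation (\<lambda>x. exp (f x))" by (intro integral_nonneg_AE) auto
  ultimately show ?thesis by linarith
qed

definition exponential_moments :: "real measure \<Rightarrow> bool" where
  "exponential_moments M \<longleftrightarrow> (\<forall>s>0. integrable M (\<lambda>x. exp (s * \<bar>x\<bar>)))"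

context real_law
begin

lemma integrable_exp_bounded:
  fixes f :: "real \<Rightarrow> real"
  assumes mom: "exponential_moments M" and [measurable]: "f \<in> borel_measurable borel"
    and f: "\<And>x. \<bar>f x\<bar> \<le> K * exp (L * \<bar>x\<bar>)"
  shows "integrable M f"
proof (rule Bochner_Integration.integrable_bound)
  have "0 \<le> K" using f[of 0] by simp
  show "integrable M (\<lambda>x. K * exp (max L 1 * \<bar>x\<bar>))"
    using mom by (simp add: exponential_moments_def)
  show "AE x in M. norm (f x) \<le> norm (K * exp (max L 1 * \<bar>x\<bar>))"
  proof (rule AE_I2)
    fix x
    have "K * exp (L * \<bar>x\<bar>) \<le> K * exp (max L 1 * \<bar>x\<bar>)"
      using \<open>0 \<le> K\<close> by (intro mult_left_mono) (auto intro: mult_right_mono)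
    then show "norm (f x) \<le> norm (K * exp (max L 1 * \<bar>x\<bar>))"
      using f[of x] \<open>0 \<le> K\<close> by simp
  qed
qed auto

lemma integrable_exp_linear_growth:
  assumes mom: "exponential_moments M" and [measurable]: "f \<in> borel_measurable borel"
    and f: "\<And>x. \<bar>f x\<bar> \<le> K + L * \<bar>x\<bar>"
  shows "integrable M (\<lambda>x. exp (f x))" "integrable M (\<lambda>x. exp (f x) * f x)"
proof -
  show "integrable M (\<lambda>x. exp (f x))"
    by (rule integrable_exp_bounded[OF mom]) (use exp_le_of_linear_growth(1)[OF f] in auto)
  show "integrable M (\<lambda>x. exp (f x) * f x)"
    by (rule integrable_exp_bounded[OF mom _ exp_le_of_linear_growth(2)[OF f]]) measurable
qed

lemma Ent_exp_le:
  assumes int: "integrable M (\<lambda>x. exp (f x))" "integrable M (\<lambda>x. exp (f x) * f x)"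
  shows "Ent M (\<lambda>x. exp (f x)) \<le> enn2ereal (\<integral>\<^sup>+x. ennreal (exp a * psi (f x - a)) \<partial>M)"
proof -
  define Z where "Z = (\<integral>x. exp (f x) \<partial>M)"
  have "0 < Z" unfolding Z_def by (rule expectation_exp_pos[OF int(1)])
  then have "Z - exp a \<le> Z * (ln Z - a)" using mult_ln_ge_diff[of Z "exp a"] by simp
  then have Z_le: "Z + a * Z - Z * ln Z \<le> exp a" by (simp add: algebra_simps)
  have psi_eq: "exp a * psi (f x - a) = exp (f x) * f x - a * exp (f x) - exp (f x) + exp a" for x
    by (simp add: psi_def exp_diff field_simps)
  have int_psi: "integrable M (\<lambda>x. exp a * psi (f x - a))"
    unfolding psi_eq using int by auto
  have "(\<integral>x. exp a * psi (f x - a) \<partial>M) = (\<integral>x. exp (f x) * f x \<partial>M) - a * Z - Z + exp a"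
    unfolding psi_eq Z_def using int by simp
  then have "(\<integral>x. exp (f x) * f x \<partial>M) - Z * ln Z \<le> (\<integral>x. exp a * psi (f x - a) \<partial>M)"
    using Z_le by simp
  moreover have "(\<integral>\<^sup>+x. ennreal (exp a * psi (f x - a)) \<partial>M) =
      ennreal (\<integral>x. exp a * psi (f x - a) \<partial>M)"
    by (rule nn_integral_eq_integral[OF int_psi]) (auto simp: psi_nonneg)
  moreover have "0 \<le> (\<integral>x. exp a * psi (f x - a) \<partial>M)"
    by (intro integral_nonneg_AE) (auto simp: psi_nonneg)
  ultimately show ?thesis
    using int(2) by (simp add: Ent_exp Z_def enn2ereal_ennreal)
qed

end

section \<open>From the transport map to the log-Sobolev inequality\<close>

locale cost_law = young_cost H t0 A \<alpha> + real_law M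
  for H :: "real \<Rightarrow> real" and t0 A \<alpha> :: real and M :: "real measure"

locale transport_bound = cost_law +
  fixes b :: real
  assumes b_pos: "0 < b"
    and U_increment: "0 < h \<Longrightarrow> U (x + h) - U x \<le> modulus h / b"
begin

lemma U_increment_abs:
  assumes "\<bar>s\<bar> = 1" "0 \<le> z" "z < y"
  shows "\<bar>U (s * y) - U (s * z)\<bar> \<le> modulus (y - z) / b"
proof (cases "s = 1")
  case True
  then show ?thesis using U_increment[of "y - z" z] U_map_mono[of z y] assms by simp
next
  case False
  then have "s = - 1" using assms by auto
  then show ?thesis using U_increment[of "y - z" "- y"] U_map_mono[of "- y" "- z"] assms by simp
qed

lemma exp_U_map_le:
  assumes "\<bar>r\<bar> = 1" "0 < y" "0 < s"
  shows "exp (s * \<bar>U (r * y)\<bar>) \<le> exp (s * \<bar>U 0\<bar> + H (2 * s / b) + t0\<^sup>2 / 2) * exp (1 / 2 * y)"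
proof -
  have "\<bar>U (r * y) - U 0\<bar> \<le> modulus y / b" using U_increment_abs[of r 0 y] assms by simp
  then have "s * \<bar>U (r * y)\<bar> \<le> s * (\<bar>U 0\<bar> + modulus y / b)"
    using assms by (intro mult_left_mono) auto
  also have "\<dots> = s * \<bar>U 0\<bar> + s / b * modulus y" by (simp add: algebra_simps)
  also have "s / b * modulus y \<le> H (s / b / (1 / 2)) + 1 / 2 * (t0\<^sup>2 + y)"
    using assms by (intro mult_modulus_le) auto
  finally show ?thesis by (simp add: field_simps flip: exp_add)
qed

lemma exponential_moments_of_transport_bound: "exponential_moments M"
  unfolding exponential_moments_def
proof (intro allI impI integrableI_nonneg)
  fix s :: real assume s: "0 < s"
  define K where "K = exp (s * \<bar>U 0\<bar> + H (2 * s / b) + t0\<^sup>2 / 2)"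
  have half: "(\<integral>\<^sup>+y. ennreal (exp (s * \<bar>U (r * y)\<bar>)) \<partial>std_exponential) \<le> ennreal K * 2"
    if r: "\<bar>r\<bar> = 1" for r
  proof -
    have "ennreal (exp (s * \<bar>U (r * y)\<bar>)) \<le> ennreal K * ennreal (exp (1 / 2 * y))" if "0 < y" for y
      using exp_U_map_le[OF r that s] by (simp add: K_def ennreal_mult[symmetric] ennreal_leI)
    then have "(\<integral>\<^sup>+y. ennreal (exp (s * \<bar>U (r * y)\<bar>)) \<partial>std_exponential) \<le>
        (\<integral>\<^sup>+y. ennreal K * ennreal (exp (1 / 2 * y)) \<partial>std_exponential)"
      by (rule nn_integral_mono_AE[OF eventually_mono[OF AE_std_exponential_pos]])
    also have "\<dots> = ennreal K * 2"
      by (subst nn_integral_cmult, measurable, subst nn_integral_exp_std_exponential) auto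
    finally show ?thesis .
  qed
  have "2 * (\<integral>\<^sup>+x. ennreal (exp (s * \<bar>x\<bar>)) \<partial>M) \<le> ennreal K * 2 + ennreal K * 2"
    using half[of 1] half[of "- 1"] by (subst nn_integral_U_map) (auto intro: add_mono)
  also have "\<dots> < \<infinity>" by (simp add: ennreal_mult_less_top)
  finally show "(\<integral>\<^sup>+x. ennreal (exp (s * \<bar>x\<bar>)) \<partial>M) < \<infinity>"
    by (auto simp: ennreal_mult_less_top)
qed auto

definition median_variance :: real where
  "median_variance = (\<integral>x. (x - U 0)\<^sup>2 \<partial>M)"

definition median_const :: real where
  "median_const = max (median_variance * b\<^sup>2 / 16) (1 / t0\<^sup>2)"

lemma integrable_square_diff_median: "integrable M (\<lambda>x. (x - U 0)\<^sup>2)"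
proof (rule integrable_exp_bounded[OF exponential_moments_of_transport_bound])
  fix x
  have "\<bar>x - U 0\<bar> \<le> exp (\<bar>x\<bar> + \<bar>U 0\<bar>)"
    using exp_ge_add_one_self[of "\<bar>x\<bar> + \<bar>U 0\<bar>"] by linarith
  then have "(x - U 0)\<^sup>2 \<le> (exp (\<bar>x\<bar> + \<bar>U 0\<bar>))\<^sup>2" by (simp add: power2_le_iff_abs_le)
  also have "\<dots> = exp (2 * \<bar>U 0\<bar>) * exp (2 * \<bar>x\<bar>)"
    by (simp add: power2_eq_square flip: exp_add)
  finally show "\<bar>(x - U 0)\<^sup>2\<bar> \<le> exp (2 * \<bar>U 0\<bar>) * exp (2 * \<bar>x\<bar>)" by simp
qed auto

lemma median_const_pos: "0 < median_const"
  using t0_pos by (simp add: median_const_def less_max_iff_disj)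

lemma min_square_le_cost: "min 1 (q\<^sup>2 * median_variance) \<le> median_const * H (8 / b * q)"
proof (cases "\<bar>8 / b * q\<bar> \<le> 2 * t0")
  case True
  have "q\<^sup>2 * median_variance = median_variance * b\<^sup>2 / 16 * H (8 / b * q)"
    using b_pos by (subst H_quad[OF True]) (simp add: power2_eq_square)
  also have "\<dots> \<le> median_const * H (8 / b * q)"
    using H_nonneg by (intro mult_right_mono) (auto simp: median_const_def)
  finally show ?thesis by simp
next
  case False
  have "1 = 1 / t0\<^sup>2 * t0\<^sup>2" using t0_pos by simp
  also have "\<dots> \<le> median_const * H (8 / b * q)"
    using False median_const_pos by (intro mult_mono H_ge_t0) (auto simp: median_const_def)
  finally show ?thesis by simp
qed

definition log_sobolev_const :: real where
  "log_sobolev_const = max 1 (2 * hardy_const + 2 * median_const)"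

end

locale subdifferentiable_potential = transport_bound +
  fixes \<phi> d :: "real \<Rightarrow> real" and L :: real
  assumes subgradient: "\<phi> x + d x * (y - x) \<le> \<phi> y"
    and lipschitz: "L-lipschitz_on UNIV \<phi>"
    and d_measurable [measurable]: "d \<in> borel_measurable borel"
begin

definition cost_density :: "real \<Rightarrow> ennreal" where
  "cost_density x = ennreal (H (8 / b * d x) * exp (\<phi> x - \<phi> (U 0)))"

lemma borel_measurable_potential [measurable]: "\<phi> \<in> borel_measurable borel"
  using lipschitz_on_continuous_on[OF lipschitz] by (rule borel_measurable_continuous_onI)

lemma borel_measurable_cost_density [measurable]: "cost_density \<in> borel_measurable borel"
  unfolding cost_density_def by measurable

lemma potential_linear_growth: "\<bar>\<phi> x - a\<bar> \<le> (\<bar>\<phi> 0\<bar> + \<bar>a\<bar>) + L * \<bar>x\<bar>"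
  using lipschitz_onD[OF lipschitz, of x 0] by (simp add: dist_real_def)

lemma nn_integral_psi_pos_finite: "(\<integral>\<^sup>+x. ennreal (psi (max (\<phi> x - a) 0)) \<partial>M) < \<infinity>"
proof -
  define f where "f x = max (\<phi> x - a) 0" for x
  have [measurable]: "f \<in> borel_measurable borel" unfolding f_def by measurable
  have "0 \<le> L" using lipschitz by (rule lipschitz_on_nonneg)
  then have growth: "\<bar>f x\<bar> \<le> (\<bar>\<phi> 0\<bar> + \<bar>a\<bar>) + L * \<bar>x\<bar>" for x
    using potential_linear_growth[of x a] by (auto simp: f_def max_def)
  have "integrable M (\<lambda>x. exp (f x))" "integrable M (\<lambda>x. exp (f x) * f x)"
    by (rule integrable_exp_linear_growth[OF exponential_moments_of_transport_bound _ growth],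
        measurable)+
  moreover have "psi (f x) = exp (f x) * f x - exp (f x) + 1" for x by (simp add: psi_def)
  ultimately have "integrable M (\<lambda>x. psi (f x))" by simp
  then show ?thesis
    unfolding f_def by (subst nn_integral_eq_integral) (auto simp: psi_nonneg)
qed

definition rise :: "real \<Rightarrow> real \<Rightarrow> real" where
  "rise s y = max (\<phi> (U (s * y)) - \<phi> (U 0)) 0"

definition rise_slope :: "real \<Rightarrow> real \<Rightarrow> real" where
  "rise_slope s y = (if 0 < rise s y then \<bar>d (U (s * y))\<bar> / b else 0)"

lemma rise_pos_eq: "0 < rise s y \<Longrightarrow> rise s y = \<phi> (U (s * y)) - \<phi> (U 0)"
  by (auto simp: rise_def max_def split: if_splits)

lemma rise_increment_le:
  assumes "\<bar>s\<bar> = 1" "0 \<le> z" "z < y"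
  shows "rise s y \<le> rise s z + rise_slope s y * modulus (y - z)"
proof (cases "0 < rise s y")
  case True
  have "rise s y - rise s z \<le> \<phi> (U (s * y)) - \<phi> (U (s * z))"
    using rise_pos_eq[OF True] by (simp add: rise_def)
  also have "\<dots> \<le> d (U (s * y)) * (U (s * y) - U (s * z))"
    using subgradient[of "U (s * y)" "U (s * z)"] by (simp add: algebra_simps)
  also have "\<dots> \<le> \<bar>d (U (s * y))\<bar> * \<bar>U (s * y) - U (s * z)\<bar>"
    using abs_ge_self by (metis abs_mult)
  also have "\<dots> \<le> \<bar>d (U (s * y))\<bar> * (modulus (y - z) / b)"
    using U_increment_abs[OF assms] by (intro mult_left_mono) auto
  finally show ?thesis using True by (simp add: rise_slope_def)
next
  case False
  moreover have "0 \<le> rise s z" by (simp add: rise_def)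
  ultimately show ?thesis by (simp add: rise_slope_def)
qed

lemma controlled_increments_rise:
  assumes "\<bar>s\<bar> = 1"
  shows "controlled_increments H t0 A \<alpha> (rise s) (rise_slope s)"
proof
  show [measurable]: "rise s \<in> borel_measurable borel" unfolding rise_def [abs_def] by measurable
  show "rise_slope s \<in> borel_measurable borel" unfolding rise_slope_def [abs_def] by measurable
qed (use b_pos rise_increment_le[OF assms] in \<open>auto simp: rise_def rise_slope_def\<close>)

lemma rise_cost_le: "ennreal (H (8 * rise_slope s y) * exp (rise s y)) \<le> cost_density (U (s * y))"
  unfolding cost_density_def
proof (intro ennreal_leI, cases "0 < rise s y")
  case True
  have "H (8 * rise_slope s y) \<le> H (8 / b * d (U (s * y)))"
    by (rule H_mono) (use True b_pos in \<open>simp add: rise_slope_def abs_mult\<close>)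
  then show "H (8 * rise_slope s y) * exp (rise s y) \<le>
      H (8 / b * d (U (s * y))) * exp (\<phi> (U (s * y)) - \<phi> (U 0))"
    unfolding rise_pos_eq[OF True] by (intro mult_right_mono) auto
qed (auto simp: rise_slope_def H_nonneg)

lemma nn_integral_psi_rise_le:
  assumes s: "\<bar>s\<bar> = 1"
  shows "(\<integral>\<^sup>+y. ennreal (psi (rise s y)) \<partial>std_exponential) \<le>
    (\<integral>\<^sup>+y. ennreal (2 * hardy_const) * cost_density (U (s * y)) \<partial>std_exponential)"
proof -
  interpret controlled_increments H t0 A \<alpha> "rise s" "rise_slope s"
    by (rule controlled_increments_rise[OF s])
  have "(\<integral>\<^sup>+y. ennreal (psi (rise s y)) \<partial>std_exponential) \<le>
      2 * (\<integral>\<^sup>+x. ennreal (psi (max (\<phi> x - \<phi> (U 0)) 0)) \<partial>M)"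
    unfolding rise_def by (rule nn_integral_U_map_le[OF _ s]) measurable
  also have "\<dots> < \<infinity>" using nn_integral_psi_pos_finite by (simp add: ennreal_mult_less_top)
  finally have "(\<integral>\<^sup>+y. ennreal (psi (rise s y)) \<partial>std_exponential) \<le>
      2 * (ennreal hardy_const *
        (\<integral>\<^sup>+y. ennreal (H (8 * rise_slope s y) * exp (rise s y)) \<partial>std_exponential))"
    by (rule hardy_inequality)
  also have "\<dots> \<le> 2 * (ennreal hardy_const * (\<integral>\<^sup>+y. cost_density (U (s * y)) \<partial>std_exponential))"
    by (intro mult_left_mono nn_integral_mono rise_cost_le) auto
  also have "\<dots> = (\<integral>\<^sup>+y. ennreal (2 * hardy_const) * cost_density (U (s * y)) \<partial>std_exponential)"
    using hardy_const_pos by (simp add: nn_integral_cmult ennreal_mult mult.assoc)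
  finally show ?thesis .
qed

lemma nn_integral_psi_pos_le:
  "(\<integral>\<^sup>+x. ennreal (psi (max (\<phi> x - \<phi> (U 0)) 0)) \<partial>M) \<le>
    ennreal (2 * hardy_const) * (\<integral>\<^sup>+x. cost_density x \<partial>M)"
proof -
  have "(\<integral>\<^sup>+x. ennreal (psi (max (\<phi> x - \<phi> (U 0)) 0)) \<partial>M) \<le>
      (\<integral>\<^sup>+x. ennreal (2 * hardy_const) * cost_density x \<partial>M)"
    by (rule nn_integral_le_of_U_map_le) (use nn_integral_psi_rise_le in \<open>auto simp: rise_def\<close>)
  then show ?thesis by (simp add: nn_integral_cmult)
qed

lemma psi_neg_le_square_diff: "psi (min (\<phi> x - \<phi> m) 0) \<le> (d m)\<^sup>2 * (x - m)\<^sup>2"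
proof (cases "\<phi> x \<le> \<phi> m")
  case True
  have "psi (min (\<phi> x - \<phi> m) 0) \<le> (\<phi> x - \<phi> m)\<^sup>2"
    using psi_le_square[of "\<phi> x - \<phi> m"] True by (simp add: min_def)
  also have "\<dots> \<le> (d m * (x - m))\<^sup>2"
    using subgradient[of m x] True by (intro abs_le_square_iff[THEN iffD1]) auto
  finally show ?thesis by (simp add: power_mult_distrib)
qed (simp add: min_def)

lemma cost_median_le_cost_density:
  assumes "0 \<le> d (U 0) * (x - U 0)"
  shows "ennreal (H (8 / b * d (U 0))) \<le> cost_density x"
proof -
  have "\<bar>d (U 0)\<bar> \<le> \<bar>d x\<bar>"
  proof (cases "x = U 0")
    case False
    have "0 \<le> (d x - d (U 0)) * (x - U 0)"
      using subgradient[of "U 0" x] subgradient[of x "U 0"] by (simp add: algebra_simps)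
    then show ?thesis using assms False by (auto simp: zero_le_mult_iff)
  qed simp
  then have "\<bar>8 / b * d (U 0)\<bar> \<le> \<bar>8 / b * d x\<bar>"
    using b_pos by (simp add: abs_mult divide_right_mono)
  then have "H (8 / b * d (U 0)) * 1 \<le> H (8 / b * d x) * exp (\<phi> x - \<phi> (U 0))"
    using subgradient[of "U 0" x] assms by (intro mult_mono H_mono) (auto simp: H_nonneg)
  then show ?thesis by (simp add: cost_density_def ennreal_leI)
qed

lemma cost_median_le: "ennreal (H (8 / b * d (U 0))) \<le> 2 * (\<integral>\<^sup>+x. cost_density x \<partial>M)"
proof -
  define s where "s = (if 0 \<le> d (U 0) then 1 else - 1 :: real)"
  have "ennreal (H (8 / b * d (U 0))) \<le> cost_density (U (s * y))" if "0 < y" for y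
  proof (rule cost_median_le_cost_density)
    show "0 \<le> d (U 0) * (U (s * y) - U 0)"
      using U_map_mono[of 0 y] U_map_mono[of "- y" 0] that
      by (auto simp: s_def intro: mult_nonneg_nonneg mult_nonpos_nonpos)
  qed
  then have "(\<integral>\<^sup>+y. ennreal (H (8 / b * d (U 0))) \<partial>std_exponential) \<le>
      (\<integral>\<^sup>+y. cost_density (U (s * y)) \<partial>std_exponential)"
    by (rule nn_integral_mono_AE[OF eventually_mono[OF AE_std_exponential_pos]])
  also have "\<dots> \<le> 2 * (\<integral>\<^sup>+x. cost_density x \<partial>M)"
    by (rule nn_integral_U_map_le) (auto simp: s_def)
  finally show ?thesis using std_exponential.emeasure_space_1 by simp
qed

lemma nn_integral_psi_neg_le:
  "(\<integral>\<^sup>+x. ennreal (psi (min (\<phi> x - \<phi> (U 0)) 0)) \<partial>M) \<le>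
    ennreal (2 * median_const) * (\<integral>\<^sup>+x. cost_density x \<partial>M)" (is "?I \<le> _")
proof -
  have "?I \<le> (\<integral>\<^sup>+x. ennreal 1 \<partial>M)"
    by (intro nn_integral_mono ennreal_leI psi_le_one) simp
  then have "?I \<le> ennreal 1" using emeasure_space_1 by simp
  moreover have "?I \<le> ennreal ((d (U 0))\<^sup>2 * median_variance)"
  proof -
    have "?I \<le> (\<integral>\<^sup>+x. ennreal ((d (U 0))\<^sup>2 * (x - U 0)\<^sup>2) \<partial>M)"
      by (intro nn_integral_mono ennreal_leI psi_neg_le_square_diff)
    also have "\<dots> = ennreal ((d (U 0))\<^sup>2 * median_variance)"
      using integrable_square_diff_median
      by (subst nn_integral_eq_integral) (auto simp: median_variance_def)
    finally show ?thesis .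
  qed
  ultimately have "?I \<le> ennreal (min 1 ((d (U 0))\<^sup>2 * median_variance))" by (simp add: min_def)
  also have "\<dots> \<le> ennreal (median_const * H (8 / b * d (U 0)))"
    by (rule ennreal_leI[OF min_square_le_cost])
  also have "\<dots> = ennreal median_const * ennreal (H (8 / b * d (U 0)))"
    using median_const_pos H_nonneg by (subst ennreal_mult) auto
  also have "\<dots> \<le> ennreal median_const * (2 * (\<integral>\<^sup>+x. cost_density x \<partial>M))"
    by (intro mult_left_mono cost_median_le) auto
  also have "\<dots> = ennreal (2 * median_const) * (\<integral>\<^sup>+x. cost_density x \<partial>M)"
    using median_const_pos by (simp add: ennreal_mult mult.assoc mult.left_commute)
  finally show ?thesis .
qed

lemma nn_integral_psi_le:
  "(\<integral>\<^sup>+x. ennreal (psi (\<phi> x - \<phi> (U 0))) \<partial>M) \<le> ennreal log_sobolev_const * (\<integral>\<^sup>+x. cost_density x \<partial>M)"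
proof -
  define f where "f x = \<phi> x - \<phi> (U 0)" for x
  have [measurable]: "f \<in> borel_measurable borel" unfolding f_def by measurable
  have "(\<integral>\<^sup>+x. ennreal (psi (f x)) \<partial>M) =
      (\<integral>\<^sup>+x. ennreal (psi (max (f x) 0)) + ennreal (psi (min (f x) 0)) \<partial>M)"
    by (intro nn_integral_cong) (auto simp: max_def min_def)
  also have "\<dots> =
      (\<integral>\<^sup>+x. ennreal (psi (max (f x) 0)) \<partial>M) + (\<integral>\<^sup>+x. ennreal (psi (min (f x) 0)) \<partial>M)"
    by (rule nn_integral_add) auto
  also have "\<dots> \<le> ennreal (2 * hardy_const) * (\<integral>\<^sup>+x. cost_density x \<partial>M) +
      ennreal (2 * median_const) * (\<integral>\<^sup>+x. cost_density x \<partial>M)"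
    unfolding f_def by (intro add_mono nn_integral_psi_pos_le nn_integral_psi_neg_le)
  also have "\<dots> = ennreal (2 * hardy_const + 2 * median_const) * (\<integral>\<^sup>+x. cost_density x \<partial>M)"
    using hardy_const_pos median_const_pos by (simp add: distrib_right)
  also have "\<dots> \<le> ennreal log_sobolev_const * (\<integral>\<^sup>+x. cost_density x \<partial>M)"
    by (intro mult_right_mono ennreal_leI) (auto simp: log_sobolev_const_def)
  finally show ?thesis by (simp add: f_def)
qed

theorem modified_log_sobolev:
  "Ent M (\<lambda>x. exp (\<phi> x)) \<le>
    enn2ereal (\<integral>\<^sup>+x. ennreal (H (log_sobolev_const * (8 / b) * d x) * exp (\<phi> x)) \<partial>M)"
proof -
  define a where "a = \<phi> (U 0)"
  note growth = potential_linear_growth[of _ 0, simplified]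
  have "(\<integral>\<^sup>+x. ennreal (exp a * psi (\<phi> x - a)) \<partial>M) =
      ennreal (exp a) * (\<integral>\<^sup>+x. ennreal (psi (\<phi> x - a)) \<partial>M)"
    by (simp add: ennreal_mult psi_nonneg nn_integral_cmult)
  also have "\<dots> \<le> ennreal (exp a) * (ennreal log_sobolev_const * (\<integral>\<^sup>+x. cost_density x \<partial>M))"
    unfolding a_def by (intro mult_left_mono nn_integral_psi_le) auto
  also have "\<dots> = (\<integral>\<^sup>+x. ennreal (exp a) * (ennreal log_sobolev_const * cost_density x) \<partial>M)"
    by (simp add: nn_integral_cmult)
  also have "\<dots> \<le> (\<integral>\<^sup>+x. ennreal (H (log_sobolev_const * (8 / b) * d x) * exp (\<phi> x)) \<partial>M)"
  proof (intro nn_integral_mono)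
    fix x
    have const_ge: "1 \<le> log_sobolev_const" by (simp add: log_sobolev_const_def)
    have "exp a * (log_sobolev_const * (H (8 / b * d x) * exp (\<phi> x - a))) =
        log_sobolev_const * H (8 / b * d x) * exp (\<phi> x)"
      by (simp add: exp_diff)
    also have "\<dots> \<le> H (log_sobolev_const * (8 / b * d x)) * exp (\<phi> x)"
      by (intro mult_right_mono H_scale const_ge) auto
    finally show "ennreal (exp a) * (ennreal log_sobolev_const * cost_density x)
        \<le> ennreal (H (log_sobolev_const * (8 / b) * d x) * exp (\<phi> x))"
      using const_ge
      by (simp add: cost_density_def a_def ennreal_mult[symmetric] H_nonneg mult.assoc ennreal_leI)
  qed
  finally have "enn2ereal (\<integral>\<^sup>+x. ennreal (exp a * psi (\<phi> x - a)) \<partial>M) \<le>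
      enn2ereal (\<integral>\<^sup>+x. ennreal (H (log_sobolev_const * (8 / b) * d x) * exp (\<phi> x)) \<partial>M)"
    by (simp add: less_eq_ennreal.rep_eq)
  moreover have "Ent M (\<lambda>x. exp (\<phi> x)) \<le> enn2ereal (\<integral>\<^sup>+x. ennreal (exp a * psi (\<phi> x - a)) \<partial>M)"
    by (intro Ent_exp_le
        integrable_exp_linear_growth[OF exponential_moments_of_transport_bound _ growth]) measurable
  ultimately show ?thesis by (rule order_trans[rotated])
qed

end

definition convex_log_sobolev :: "real measure \<Rightarrow> (real \<Rightarrow> real) \<Rightarrow> real \<Rightarrow> bool" where
  "convex_log_sobolev M H c \<longleftrightarrow>
    (\<forall>\<phi>. smooth \<phi> \<and> convex_on UNIV \<phi> \<and> (\<exists>L. L-lipschitz_on UNIV \<phi>) \<longrightarrow>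
      Ent M (\<lambda>x. exp (\<phi> x)) \<le> enn2ereal (\<integral>\<^sup>+x. ennreal (H (c * deriv \<phi> x) * exp (\<phi> x)) \<partial>M))"

lemma smooth_has_real_derivative:
  assumes "smooth f"
  shows "(f has_real_derivative deriv f x) (at x)"
  using assms[unfolded smooth_def, rule_format, of 0] DERIV_deriv_iff_real_differentiable by auto

lemma smooth_continuous_on_deriv:
  assumes "smooth f"
  shows "continuous_on UNIV (deriv f)"
  using assms[unfolded smooth_def, rule_format, of 1] differentiable_imp_continuous_within
  by (auto simp: continuous_on_eq_continuous_within)

theorem (in transport_bound) convex_log_sobolev_of_transport_bound:
  "\<exists>c>0. convex_log_sobolev M H c"
proof (intro exI conjI)
  show "0 < log_sobolev_const * (8 / b)" using b_pos by (simp add: log_sobolev_const_def)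
  show "convex_log_sobolev M H (log_sobolev_const * (8 / b))"
    unfolding convex_log_sobolev_def
  proof (intro allI impI, elim conjE exE)
    fix \<phi> :: "real \<Rightarrow> real" and L :: real
    assume \<phi>: "smooth \<phi>" "convex_on UNIV \<phi>" "L-lipschitz_on UNIV \<phi>"
    interpret subdifferentiable_potential H t0 A \<alpha> M b \<phi> "deriv \<phi>" L
    proof
      show "\<phi> x + deriv \<phi> x * (y - x) \<le> \<phi> y" for x y
        using convex_on_imp_above_tangent[OF \<phi>(2), of x y "deriv \<phi> x"]
          smooth_has_real_derivative[OF \<phi>(1)] by simp
      show "deriv \<phi> \<in> borel_measurable borel"
        by (rule borel_measurable_continuous_onI[OF smooth_continuous_on_deriv[OF \<phi>(1)]])
    qed (rule \<phi>(3))
    show "Ent M (\<lambda>x. exp (\<phi> x)) \<le>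
        enn2ereal (\<integral>\<^sup>+x. ennreal (H (log_sobolev_const * (8 / b) * deriv \<phi> x) * exp (\<phi> x)) \<partial>M)"
      by (rule modified_log_sobolev)
  qed
qed

section \<open>The log-Sobolev inequality for hinges\<close>

lemma smoothI_deriv_poly:
  assumes f: "\<And>x. (f has_real_derivative poly q (g x)) (at x)"
    and g: "\<And>x. (g has_real_derivative poly r (g x)) (at x)"
  shows "smooth f"
proof -
  have poly_g: "((\<lambda>x. poly p (g x)) has_real_derivative poly (pderiv p * r) (g x)) (at x)" for p x
    using DERIV_chain2[OF poly_DERIV g] by simp
  have "\<exists>p. (deriv ^^ k) (\<lambda>x. poly q (g x)) = (\<lambda>x. poly p (g x))" for k
  proof (induction k)
    case (Suc k)
    then obtain p where "(deriv ^^ k) (\<lambda>x. poly q (g x)) = (\<lambda>x. poly p (g x))" by blast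
    then show ?case using DERIV_imp_deriv[OF poly_g] by (auto intro!: exI[of _ "pderiv p * r"])
  qed auto
  then have diff: "((deriv ^^ k) (\<lambda>x. poly q (g x))) differentiable (at x)" for k x
    using poly_g real_differentiable_def by metis
  have "deriv f = (\<lambda>x. poly q (g x))"
    using DERIV_imp_deriv[OF f] by auto
  then have "((deriv ^^ k) f) differentiable (at x)" for k x
    using diff[of "k - 1" x] f[of x] real_differentiable_def
    by (cases k) (auto simp: funpow_swap1[symmetric] funpow_Suc_right simp del: funpow.simps)
  then show ?thesis by (simp add: smooth_def)
qed

text \<open>The shift by \<open>k\<close> makes the derivative vanish in the limit also at the kink \<open>w = 0\<close>,
  which may carry an atom.\<close>

definition soft_hinge :: "real \<Rightarrow> real \<Rightarrow> real" where
  "soft_hinge k w = ln (1 + exp (k\<^sup>2 * w - k)) / k\<^sup>2"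

definition soft_step :: "real \<Rightarrow> real \<Rightarrow> real" where
  "soft_step k w = 1 / (1 + exp (k - k\<^sup>2 * w))"

lemma soft_step_pos: "0 < soft_step k w" and soft_step_less_1: "soft_step k w < 1"
  by (auto simp: soft_step_def add_pos_pos)

lemma soft_step_mono: "v \<le> w \<Longrightarrow> soft_step k v \<le> soft_step k w"
  unfolding soft_step_def
  by (intro divide_left_mono mult_pos_pos add_pos_pos) (auto intro: mult_left_mono)

lemma has_real_derivative_soft_hinge:
  assumes "k \<noteq> 0"
  shows "(soft_hinge k has_real_derivative soft_step k w) (at w)"
proof -
  have "0 < 1 + exp (k\<^sup>2 * w - k)" by (simp add: add_pos_pos)
  then have "((\<lambda>w. ln (1 + exp (k\<^sup>2 * w - k))) has_real_derivative
      exp (k\<^sup>2 * w - k) / (1 + exp (k\<^sup>2 * w - k)) * k\<^sup>2) (at w)"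
    by (auto intro!: derivative_eq_intros)
  moreover have "exp (k\<^sup>2 * w - k) / (1 + exp (k\<^sup>2 * w - k)) = soft_step k w"
    by (simp add: soft_step_def exp_diff field_simps)
  ultimately show ?thesis
    using assms DERIV_cdivide[of _ "soft_step k w * k\<^sup>2" w UNIV "k\<^sup>2"]
    unfolding soft_hinge_def [abs_def] by simp
qed

lemma has_real_derivative_soft_step:
  "(soft_step k has_real_derivative k\<^sup>2 * (soft_step k w * (1 - soft_step k w))) (at w)"
proof -
  have "1 + exp (k - k\<^sup>2 * w) \<noteq> 0" using exp_gt_zero[of "k - k\<^sup>2 * w"] by linarith
  then show ?thesis
    unfolding soft_step_def [abs_def]
    by (auto intro!: derivative_eq_intros simp: field_simps power2_eq_square)
qed

lemma soft_hinge_bounds: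
  shows "0 \<le> soft_hinge k w"
    and "1 \<le> k \<Longrightarrow> soft_hinge k w \<le> \<bar>w\<bar> + 2"
proof -
  show "0 \<le> soft_hinge k w" unfolding soft_hinge_def by (intro divide_nonneg_nonneg ln_ge_zero) auto
  assume k: "1 \<le> k"
  then have square_ge: "k \<le> k\<^sup>2" "1 \<le> k\<^sup>2"
    using mult_left_mono[of 1 k k] one_le_power[of k 2] by (auto simp: power2_eq_square)
  have "k\<^sup>2 * w \<le> k\<^sup>2 * \<bar>w\<bar>" by (intro mult_left_mono) auto
  then have "k\<^sup>2 * w - k \<le> k\<^sup>2 * \<bar>w\<bar> + k" using k by linarith
  then have "exp (k\<^sup>2 * w - k) \<le> exp (k\<^sup>2 * \<bar>w\<bar> + k)" by (subst exp_le_cancel_iff)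
  moreover have "1 \<le> exp (k\<^sup>2 * \<bar>w\<bar> + k)" using k by simp
  ultimately have "1 + exp (k\<^sup>2 * w - k) \<le> 2 * exp (k\<^sup>2 * \<bar>w\<bar> + k)" by linarith
  then have "ln (1 + exp (k\<^sup>2 * w - k)) \<le> ln (2 * exp (k\<^sup>2 * \<bar>w\<bar> + k))"
    by (subst ln_le_cancel_iff) (auto simp: add_pos_pos)
  also have "\<dots> \<le> 1 + (k\<^sup>2 * \<bar>w\<bar> + k)"
    using ln_le_minus_one[of "2 :: real"] by (simp add: ln_mult)
  also have "\<dots> \<le> (\<bar>w\<bar> + 2) * k\<^sup>2" using square_ge by (simp add: algebra_simps)
  finally show "soft_hinge k w \<le> \<bar>w\<bar> + 2"
    using square_ge by (simp add: soft_hinge_def divide_le_eq)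
qed

lemma abs_affine_le: "\<bar>a * x - u\<bar> \<le> \<bar>u\<bar> + \<bar>a\<bar> * \<bar>x\<bar>" for a x u :: real
  using abs_triangle_ineq4[of "a * x" u] by (simp add: abs_mult)

lemma soft_hinge_affine_le:
  "1 \<le> k \<Longrightarrow> \<bar>soft_hinge k (a * x - u)\<bar> \<le> (\<bar>u\<bar> + 2) + \<bar>a\<bar> * \<bar>x\<bar>"
  using soft_hinge_bounds[of k "a * x - u"] abs_affine_le[of a x u] by simp

lemma abs_mult_soft_step_le: "\<bar>a * soft_step k w\<bar> \<le> \<bar>a\<bar>"
  using soft_step_pos[of k w] soft_step_less_1[of k w] by (auto simp: abs_mult intro!: mult_left_le)

lemma borel_measurable_soft_hinge [measurable]: "soft_hinge k \<in> borel_measurable borel"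
  unfolding soft_hinge_def [abs_def] by measurable

lemma borel_measurable_soft_step [measurable]: "soft_step k \<in> borel_measurable borel"
  unfolding soft_step_def [abs_def] by measurable

lemma tendsto_soft_hinge: "((\<lambda>k. soft_hinge k w) \<longlongrightarrow> max w 0) at_top"
proof -
  consider (pos) "0 < w" | (zero) "w = 0" | (neg) "w < 0" by linarith
  then show ?thesis
  proof cases
    case pos
    then have "((\<lambda>k. ln (1 + exp (k\<^sup>2 * w - k)) / k\<^sup>2) \<longlongrightarrow> w) at_top" by real_asymp
    then show ?thesis using pos by (simp add: soft_hinge_def)
  next
    case zero
    have "((\<lambda>k. ln (1 + exp (- k)) / k\<^sup>2) \<longlongrightarrow> (0 :: real)) at_top" by real_asymp
    then show ?thesis using zero by (simp add: soft_hinge_def)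
  next
    case neg
    then have "((\<lambda>k. ln (1 + exp (k\<^sup>2 * w - k)) / k\<^sup>2) \<longlongrightarrow> 0) at_top" by real_asymp
    then show ?thesis using neg by (simp add: soft_hinge_def)
  qed
qed

lemma tendsto_soft_step: "((\<lambda>k. soft_step k w) \<longlongrightarrow> indicator {0<..} w) at_top"
proof -
  consider (pos) "0 < w" | (zero) "w = 0" | (neg) "w < 0" by linarith
  then show ?thesis
  proof cases
    case pos
    then have "((\<lambda>k. 1 / (1 + exp (k - k\<^sup>2 * w))) \<longlongrightarrow> 1) at_top" by real_asymp
    then show ?thesis using pos by (simp add: soft_step_def)
  next
    case zero
    have "((\<lambda>k. 1 / (1 + exp k)) \<longlongrightarrow> (0 :: real)) at_top" by real_asymp
    then show ?thesis using zero by (simp add: soft_step_def)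
  next
    case neg
    then have "((\<lambda>k. 1 / (1 + exp (k - k\<^sup>2 * w))) \<longlongrightarrow> 0) at_top" by real_asymp
    then show ?thesis using neg by (simp add: soft_step_def)
  qed
qed

lemma has_real_derivative_soft_hinge_affine:
  assumes "k \<noteq> 0"
  shows "((\<lambda>x. soft_hinge k (a * x - u)) has_real_derivative a * soft_step k (a * x - u)) (at x)"
proof -
  have "((\<lambda>x. soft_hinge k (a * x - u)) has_real_derivative soft_step k (a * x - u) * a) (at x)"
    by (rule DERIV_chain2[OF has_real_derivative_soft_hinge[OF assms]])
      (auto intro!: derivative_eq_intros)
  then show ?thesis by (rule DERIV_cong) simp
qed

lemma smooth_soft_hinge_affine:
  assumes "k \<noteq> 0"
  shows "smooth (\<lambda>x. soft_hinge k (a * x - u))"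
proof (rule smoothI_deriv_poly)
  fix x
  show "((\<lambda>x. soft_hinge k (a * x - u)) has_real_derivative
      poly [:0, a:] (soft_step k (a * x - u))) (at x)"
    by (rule DERIV_cong[OF has_real_derivative_soft_hinge_affine[OF assms]]) simp
  have "((\<lambda>x. soft_step k (a * x - u)) has_real_derivative
      k\<^sup>2 * (soft_step k (a * x - u) * (1 - soft_step k (a * x - u))) * a) (at x)"
    by (rule DERIV_chain2[OF has_real_derivative_soft_step]) (auto intro!: derivative_eq_intros)
  then show "((\<lambda>x. soft_step k (a * x - u)) has_real_derivative
      poly [:0, k\<^sup>2 * a, - (k\<^sup>2 * a):] (soft_step k (a * x - u))) (at x)"
    by (rule DERIV_cong) (simp add: algebra_simps)
qed

lemma convex_on_soft_hinge_affine:
  assumes "k \<noteq> 0"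
  shows "convex_on UNIV (\<lambda>x. soft_hinge k (a * x - u))"
proof (rule convex_on_realI[OF _ has_real_derivative_soft_hinge_affine[OF assms]])
  fix x y :: real assume "x \<le> y"
  show "a * soft_step k (a * x - u) \<le> a * soft_step k (a * y - u)"
  proof (cases "0 \<le> a")
    case True
    then show ?thesis
      using \<open>x \<le> y\<close> by (intro mult_left_mono soft_step_mono) (auto intro: mult_left_mono)
  next
    case False
    then show ?thesis
      using \<open>x \<le> y\<close> by (intro mult_left_mono_neg soft_step_mono) (auto intro: mult_left_mono_neg)
  qed
qed auto

lemma lipschitz_on_soft_hinge_affine:
  assumes "k \<noteq> 0"
  shows "\<bar>a\<bar>-lipschitz_on UNIV (\<lambda>x. soft_hinge k (a * x - u))"
proof (rule lipschitz_onI)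
  fix x y :: real
  have "norm (soft_hinge k (a * x - u) - soft_hinge k (a * y - u)) \<le> \<bar>a\<bar> * norm (x - y)"
  proof (rule field_differentiable_bound[of UNIV])
    show "((\<lambda>x. soft_hinge k (a * x - u)) has_field_derivative a * soft_step k (a * z - u))
      (at z within UNIV)" for z using has_real_derivative_soft_hinge_affine[OF assms] by simp
    show "norm (a * soft_step k (a * z - u)) \<le> \<bar>a\<bar>" for z
      using abs_mult_soft_step_le by simp
  qed auto
  then show "dist (soft_hinge k (a * x - u)) (soft_hinge k (a * y - u)) \<le> \<bar>a\<bar> * dist x y"
    by (simp add: dist_real_def)
qed simp

context real_law
begin

lemma tendsto_integral_exp_bounded:
  fixes f :: "real \<Rightarrow> real \<Rightarrow> real"
  assumes mom: "exponential_moments M"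
    and [measurable]: "\<And>k. f k \<in> borel_measurable borel" "g \<in> borel_measurable borel"
    and bound: "\<And>k x. 1 \<le> k \<Longrightarrow> \<bar>f k x\<bar> \<le> K * exp (L * \<bar>x\<bar>)"
    and lim: "\<And>x. ((\<lambda>k. f k x) \<longlongrightarrow> g x) at_top"
  shows "((\<lambda>k. \<integral>x. f k x \<partial>M) \<longlongrightarrow> (\<integral>x. g x \<partial>M)) at_top"
proof (rule integral_dominated_convergence_at_top)
  show "integrable M (\<lambda>x. K * exp (L * \<bar>x\<bar>))"
    by (rule integrable_exp_bounded[OF mom, of _ "\<bar>K\<bar>" L]) (auto simp: abs_mult)
  show "eventually (\<lambda>k. AE x in M. norm (f k x) \<le> K * exp (L * \<bar>x\<bar>)) at_top"
    using eventually_ge_at_top[of 1] by eventually_elim (use bound in auto)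
qed (use lim in auto)

lemma tendsto_Ent_exp:
  fixes f :: "real \<Rightarrow> real \<Rightarrow> real"
  assumes mom: "exponential_moments M"
    and [measurable]: "\<And>k. f k \<in> borel_measurable borel" "g \<in> borel_measurable borel"
    and f: "\<And>k x. 1 \<le> k \<Longrightarrow> \<bar>f k x\<bar> \<le> K + L * \<bar>x\<bar>" and g: "\<And>x. \<bar>g x\<bar> \<le> K + L * \<bar>x\<bar>"
    and lim: "\<And>x. ((\<lambda>k. f k x) \<longlongrightarrow> g x) at_top"
  shows "((\<lambda>k. Ent M (\<lambda>x. exp (f k x))) \<longlongrightarrow> Ent M (\<lambda>x. exp (g x))) at_top"
proof -
  let ?E = "\<lambda>h. ereal ((\<integral>x. exp (h x) * h x \<partial>M) -
    (\<integral>x. exp (h x) \<partial>M) * ln (\<integral>x. exp (h x) \<partial>M))"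
  note int_f = integrable_exp_linear_growth[OF mom _ f]
    and int_g = integrable_exp_linear_growth[OF mom _ g]
  have "((\<lambda>k. \<integral>x. exp (f k x) \<partial>M) \<longlongrightarrow> (\<integral>x. exp (g x) \<partial>M)) at_top"
    by (rule tendsto_integral_exp_bounded[OF mom, of _ _ "exp K" L])
       (use exp_le_of_linear_growth(1)[OF f] in \<open>auto intro!: tendsto_exp lim\<close>)
  moreover have "((\<lambda>k. \<integral>x. exp (f k x) * f k x \<partial>M) \<longlongrightarrow> (\<integral>x. exp (g x) * g x \<partial>M)) at_top"
    by (rule tendsto_integral_exp_bounded[OF mom _ _ exp_le_of_linear_growth(2)[OF f]])
       (auto intro!: tendsto_mult tendsto_exp lim)
  moreover have "(\<integral>x. exp (g x) \<partial>M) \<noteq> 0"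
    using expectation_exp_pos[OF int_g(1)] by simp
  ultimately have "((\<lambda>k. ?E (f k)) \<longlongrightarrow> ?E g) at_top" by (intro tendsto_intros)
  then have "((\<lambda>k. ?E (f k)) \<longlongrightarrow> Ent M (\<lambda>x. exp (g x))) at_top" using int_g by (simp add: Ent_exp)
  moreover have "eventually (\<lambda>k. ?E (f k) = Ent M (\<lambda>x. exp (f k x))) at_top"
    using eventually_ge_at_top[of 1] by eventually_elim (simp add: Ent_exp int_f)
  ultimately show ?thesis by (rule Lim_transform_eventually)
qed

end

locale log_sobolev_law = cost_law +
  fixes c :: real
  assumes c_pos: "0 < c"
    and exponential_moments: "exponential_moments M"
    and log_sobolev: "convex_log_sobolev M H c"
begin

definition soft_hinge_cost :: "real \<Rightarrow> real \<Rightarrow> real \<Rightarrow> real \<Rightarrow> real" where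
  "soft_hinge_cost a u k x = H (c * (a * soft_step k (a * x - u))) * exp (soft_hinge k (a * x - u))"

lemma borel_measurable_soft_hinge_cost [measurable]:
  "soft_hinge_cost a u k \<in> borel_measurable borel"
  unfolding soft_hinge_cost_def [abs_def] by measurable

lemma soft_hinge_cost_nonneg: "0 \<le> soft_hinge_cost a u k x"
  by (simp add: soft_hinge_cost_def H_nonneg)

lemma soft_hinge_cost_le:
  assumes "1 \<le> k"
  shows "\<bar>soft_hinge_cost a u k x\<bar> \<le> H (c * a) * exp (\<bar>u\<bar> + 2) * exp (\<bar>a\<bar> * \<bar>x\<bar>)"
proof -
  have "H (c * (a * soft_step k (a * x - u))) \<le> H (c * a)"
    using c_pos abs_mult_soft_step_le[of a k "a * x - u"]
    by (intro H_mono) (auto simp: abs_mult intro!: mult_left_mono)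
  then show ?thesis
    unfolding soft_hinge_cost_def abs_mult mult.assoc
    using exp_le_of_linear_growth(1)[OF soft_hinge_affine_le[OF assms, of a x u]]
    by (intro mult_mono) (auto simp: H_nonneg)
qed

lemma tendsto_soft_hinge_cost:
  "((\<lambda>k. soft_hinge_cost a u k x) \<longlongrightarrow>
    H (c * a) * (exp (a * x - u) * indicator {x. 0 < a * x - u} x)) at_top"
proof -
  have "((\<lambda>k. soft_hinge_cost a u k x) \<longlongrightarrow>
      H (c * (a * indicator {0<..} (a * x - u))) * exp (max (a * x - u) 0)) at_top"
    unfolding soft_hinge_cost_def
    by (intro tendsto_mult tendsto_exp tendsto_soft_hinge
        continuous_on_tendsto_compose[OF continuous_on_H[of UNIV]]
        tendsto_const tendsto_soft_step) auto
  then show ?thesis by (auto simp: indicator_def max_def split: if_splits)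
qed

lemma Ent_soft_hinge_le:
  assumes "1 \<le> k"
  shows "Ent M (\<lambda>x. exp (soft_hinge k (a * x - u))) \<le> ereal (\<integral>x. soft_hinge_cost a u k x \<partial>M)"
    (is "Ent M (\<lambda>x. exp (?\<phi> x)) \<le> _")
proof -
  have "k \<noteq> 0" using assms by simp
  then have "deriv ?\<phi> = (\<lambda>x. a * soft_step k (a * x - u))"
    by (intro ext DERIV_imp_deriv has_real_derivative_soft_hinge_affine)
  then have "Ent M (\<lambda>x. exp (?\<phi> x)) \<le> enn2ereal (\<integral>\<^sup>+x. ennreal (soft_hinge_cost a u k x) \<partial>M)"
    unfolding soft_hinge_cost_def
    using log_sobolev[unfolded convex_log_sobolev_def, rule_format, of ?\<phi>] \<open>k \<noteq> 0\<close>
      smooth_soft_hinge_affine convex_on_soft_hinge_affine lipschitz_on_soft_hinge_affine by metis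
  also have "(\<integral>\<^sup>+x. ennreal (soft_hinge_cost a u k x) \<partial>M) =
      ennreal (\<integral>x. soft_hinge_cost a u k x \<partial>M)"
  proof (rule nn_integral_eq_integral)
    show "integrable M (soft_hinge_cost a u k)"
      by (rule integrable_exp_bounded[OF exponential_moments _ soft_hinge_cost_le[OF assms]])
        measurable
  qed (simp add: soft_hinge_cost_nonneg)
  also have "enn2ereal \<dots> = ereal (\<integral>x. soft_hinge_cost a u k x \<partial>M)"
    by (intro enn2ereal_ennreal integral_nonneg_AE) (simp add: soft_hinge_cost_nonneg)
  finally show ?thesis .
qed

theorem Ent_hinge_le:
  "Ent M (\<lambda>x. exp (max (a * x - u) 0)) \<le>
    ereal (H (c * a) * (\<integral>x. exp (a * x - u) * indicator {x. 0 < a * x - u} x \<partial>M))"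
proof -
  have lim_Ent: "((\<lambda>k. Ent M (\<lambda>x. exp (soft_hinge k (a * x - u)))) \<longlongrightarrow>
      Ent M (\<lambda>x. exp (max (a * x - u) 0))) at_top"
  proof (rule tendsto_Ent_exp[OF exponential_moments _ _ soft_hinge_affine_le])
    show "\<bar>max (a * x - u) 0\<bar> \<le> (\<bar>u\<bar> + 2) + \<bar>a\<bar> * \<bar>x\<bar>" for x
      using abs_affine_le[of a x u] by (cases "0 \<le> a * x - u") auto
  qed (auto intro: tendsto_soft_hinge)
  have lim_cost: "((\<lambda>k. ereal (\<integral>x. soft_hinge_cost a u k x \<partial>M)) \<longlongrightarrow>
      ereal (\<integral>x. H (c * a) * (exp (a * x - u) * indicator {x. 0 < a * x - u} x) \<partial>M)) at_top"
    by (intro tendsto_ereal tendsto_soft_hinge_cost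
        tendsto_integral_exp_bounded[OF exponential_moments _ _ soft_hinge_cost_le]) measurable
  have "eventually (\<lambda>k. Ent M (\<lambda>x. exp (soft_hinge k (a * x - u))) \<le>
      ereal (\<integral>x. soft_hinge_cost a u k x \<partial>M)) at_top"
    using eventually_ge_at_top[of 1] by eventually_elim (rule Ent_soft_hinge_le)
  from tendsto_le[OF trivial_limit_at_top_linorder lim_cost lim_Ent this] show ?thesis by simp
qed

end

section \<open>Conditional exponential moments\<close>

lemma two_point_entropy_variational:
  fixes p q r Y :: real
  assumes p: "0 \<le> p" "p \<le> 1" and pos: "0 < q" "0 < r" "0 < Y" and mean: "p * q + (1 - p) * r = 1"
  defines "Z \<equiv> 1 - p + p * Y"
  shows "p * Y * ln q + (1 - p) * ln r \<le> p * Y * ln Y - Z * ln Z"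
proof -
  have Z: "0 < Z"
  proof (cases "p = 1")
    case False
    then show ?thesis unfolding Z_def using p pos by (intro add_pos_nonneg) auto
  qed (use pos in \<open>simp add: Z_def\<close>)
  have "p * (Y - q * Z) + (1 - p) * (1 - r * Z) \<le>
      p * (Y * (ln Y - ln (q * Z))) + (1 - p) * (1 * (ln 1 - ln (r * Z)))"
    using p pos Z by (intro add_mono mult_left_mono mult_ln_ge_diff) auto
  moreover have "p * (Y - q * Z) + (1 - p) * (1 - r * Z) = 0"
  proof -
    have "p * (Y - q * Z) + (1 - p) * (1 - r * Z) = Z - (p * q + (1 - p) * r) * Z"
      by (simp add: Z_def algebra_simps)
    then show ?thesis unfolding mean by simp
  qed
  moreover have "p * (Y * (ln Y - ln (q * Z))) + (1 - p) * (1 * (ln 1 - ln (r * Z))) =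
      p * Y * ln Y - Z * ln Z - (p * Y * ln q + (1 - p) * ln r)"
  proof -
    have "Z * ln Z = (1 - p) * ln Z + p * Y * ln Z" by (simp add: Z_def algebra_simps)
    then show ?thesis using pos Z by (simp add: ln_mult algebra_simps)
  qed
  ultimately show ?thesis by linarith
qed

text \<open>The tilt \<open>(3/2, r)\<close> gives the first point the weight \<open>3p/2\<close>.\<close>

lemma two_point_entropy_ge:
  fixes p Y :: real
  assumes p: "0 < p" "p \<le> 1 / 2" and Y: "0 < Y"
  defines "Z \<equiv> 1 - p + p * Y"
  shows "p * (Y / 3 - 1) \<le> p * Y * ln Y - Z * ln Z"
proof -
  define r where "r = (1 - 3 / 2 * p) / (1 - p)"
  have r: "0 < r" unfolding r_def using p by auto
  have "p * Y * ln (3 / 2) + (1 - p) * ln r \<le> p * Y * ln Y - Z * ln Z"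
    unfolding Z_def by (rule two_point_entropy_variational) (use p Y r in \<open>auto simp: r_def\<close>)
  moreover have "p * Y * (1 / 3) \<le> p * Y * ln (3 / 2)"
    using mult_ln_ge_diff[of "3 / 2" 1] p Y by (intro mult_left_mono) auto
  moreover have "- p \<le> (1 - p) * ln r"
  proof -
    have "1 - 1 / r \<le> ln r" using mult_ln_ge_diff[of r 1] r by (simp add: field_simps)
    then have "(1 - p) * (1 - 1 / r) \<le> (1 - p) * ln r" using p by (intro mult_left_mono) auto
    moreover have "(1 - p) * (1 / r) \<le> 1"
      using p mult_left_mono[of p "1 / 2" p] by (simp add: r_def field_simps)
    ultimately show ?thesis by (simp add: algebra_simps)
  qed
  ultimately show ?thesis by (simp add: algebra_simps)
qed

definition (in real_law) cond_cgf :: "(real \<Rightarrow> real) \<Rightarrow> real" where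
  "cond_cgf X = ln ((\<integral>x. exp (X x) * indicator {x. 0 < X x} x \<partial>M) / prob {x. 0 < X x})"

locale exceedance = real_law +
  fixes X :: "real \<Rightarrow> real"
  assumes X_measurable [measurable]: "X \<in> borel_measurable borel"
    and prob_pos: "0 < prob {x. 0 < X x}"
    and integrable_exp_double: "integrable M (\<lambda>x. exp (2 * max (X x) 0))"
begin

abbreviation S :: "real set" where "S \<equiv> {x. 0 < X x}"

abbreviation V :: real where "V \<equiv> cond_cgf X"

lemma integrable_exp_pos_part:
  "integrable M (\<lambda>x. exp (max (X x) 0))" "integrable M (\<lambda>x. exp (max (X x) 0) * max (X x) 0)"
proof -
  show "integrable M (\<lambda>x. exp (max (X x) 0))"
    by (rule Bochner_Integration.integrable_bound[OF integrable_exp_double]) auto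
  have "\<bar>exp (max (X x) 0) * max (X x) 0\<bar> \<le> exp (2 * max (X x) 0)" for x
    using exp_mult_le_exp_double[of "max (X x) 0"] by simp
  then show "integrable M (\<lambda>x. exp (max (X x) 0) * max (X x) 0)"
    by (intro Bochner_Integration.integrable_bound[OF integrable_exp_double]) auto
qed

lemma integrable_indicator_S: "integrable M (indicator S :: real \<Rightarrow> real)"
  by (simp add: emeasure_eq_measure)

lemma integrable_exp_S: "integrable M (\<lambda>x. exp (X x) * indicator S x)"
proof -
  have "(\<lambda>x. exp (X x) * indicator S x) = (\<lambda>x. exp (max (X x) 0) * indicator S x)"
    by (auto simp: indicator_def)
  then show ?thesis
    using integrable_real_mult_indicator[OF _ integrable_exp_pos_part(1), of S] by simp
qed

lemma integral_exp_S: "(\<integral>x. exp (X x) * indicator S x \<partial>M) = prob S * exp V"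
proof -
  have "(\<integral>x. indicator S x \<partial>M) \<le> (\<integral>x. exp (X x) * indicator S x \<partial>M)"
    by (rule integral_mono[OF integrable_indicator_S integrable_exp_S]) (auto simp: indicator_def)
  then have "prob S \<le> (\<integral>x. exp (X x) * indicator S x \<partial>M)" by simp
  then show ?thesis using prob_pos by (simp add: cond_cgf_def)
qed

lemma integral_exp_pos_part: "(\<integral>x. exp (max (X x) 0) \<partial>M) = 1 - prob S + prob S * exp V"
proof -
  have "(\<integral>x. exp (max (X x) 0) \<partial>M) = (\<integral>x. exp (X x) * indicator S x + (1 - indicator S x) \<partial>M)"
    by (intro Bochner_Integration.integral_cong) (auto simp: indicator_def max_def)
  also have "\<dots> = (\<integral>x. exp (X x) * indicator S x \<partial>M) + (1 - prob S)"
    using integrable_exp_S integrable_indicator_S by simp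
  finally show ?thesis by (simp add: integral_exp_S)
qed

lemma mult_cond_cgf_le: "prob S * exp V * V \<le> (\<integral>x. exp (max (X x) 0) * max (X x) 0 \<partial>M)"
proof -
  have "(exp (X x) * indicator S x) * (1 + V) - exp V * indicator S x \<le>
      exp (max (X x) 0) * max (X x) 0" for x
  proof (cases "x \<in> S")
    case True
    have "exp (X x) - exp V \<le> exp (X x) * (ln (exp (X x)) - ln (exp V))"
      by (intro mult_ln_ge_diff) auto
    then show ?thesis using True by (simp add: max_def algebra_simps)
  qed simp
  then have "(\<integral>x. (exp (X x) * indicator S x) * (1 + V) - exp V * indicator S x \<partial>M) \<le>
      (\<integral>x. exp (max (X x) 0) * max (X x) 0 \<partial>M)"
    using integrable_exp_S integrable_indicator_S integrable_exp_pos_part(2)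
    by (intro integral_mono) auto
  moreover have "(\<integral>x. (exp (X x) * indicator S x) * (1 + V) - exp V * indicator S x \<partial>M) =
      prob S * exp V * (1 + V) - exp V * prob S"
    using integrable_exp_S integrable_indicator_S integral_exp_S by simp
  ultimately show ?thesis by (simp add: algebra_simps)
qed

lemma entropy_le_iff:
  "Ent M (\<lambda>x. exp (max (X x) 0)) \<le> ereal (h * (\<integral>x. exp (X x) * indicator S x \<partial>M)) \<longleftrightarrow>
    (\<integral>x. exp (max (X x) 0) * max (X x) 0 \<partial>M) -
      (1 - prob S + prob S * exp V) * ln (1 - prob S + prob S * exp V) \<le> h * (prob S * exp V)"
  using integrable_exp_pos_part by (simp add: Ent_exp integral_exp_pos_part integral_exp_S)

lemma cond_cgf_le_ln_6:
  assumes "Ent M (\<lambda>x. exp (max (X x) 0)) \<le> ereal (h * (\<integral>x. exp (X x) * indicator S x \<partial>M))"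
    and "h \<le> 1 / 6" "prob S \<le> 1 / 2"
  shows "V \<le> ln 6"
proof -
  have "prob S * (exp V / 3 - 1) \<le> prob S * exp V * ln (exp V) -
      (1 - prob S + prob S * exp V) * ln (1 - prob S + prob S * exp V)"
    by (rule two_point_entropy_ge) (use prob_pos assms in auto)
  also have "\<dots> \<le> h * (prob S * exp V)"
    using assms(1) mult_cond_cgf_le by (simp add: entropy_le_iff)
  also have "\<dots> \<le> 1 / 6 * (prob S * exp V)" using assms by (intro mult_right_mono) auto
  finally have "prob S * (exp V / 3 - 1) \<le> prob S * (exp V / 6)" by simp
  then have "exp V \<le> 6" using prob_pos by (simp only: mult_le_cancel_left_pos)
  then show ?thesis by (subst ln_ge_iff) auto
qed

lemma exceedance_half: "exceedance M (\<lambda>x. X x / 2)"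
proof
  have "exp (2 * max (X x / 2) 0) = exp (max (X x) 0)" for x by (auto simp: max_def)
  then show "integrable M (\<lambda>x. exp (2 * max (X x / 2) 0))"
    using integrable_exp_pos_part(1) by simp
qed (use prob_pos in auto)

lemma cond_cgf_halve_tilted:
  "exp (- t) * ((1 + t) * (exp (X x) * indicator S x) - 1 / 2 * (exp (max (X x) 0) * max (X x) 0))
    \<le> exp (X x / 2) * indicator S x"
proof (cases "x \<in> S")
  case True
  have "exp (- t) * exp (X x) * (1 + (t - X x / 2)) \<le> exp (- t) * exp (X x) * exp (t - X x / 2)"
    by (intro mult_left_mono exp_ge_add_one_self) auto
  also have "\<dots> = exp (X x / 2)" by (simp flip: exp_add)
  finally show ?thesis using True by (simp add: max_def algebra_simps)
qed (simp add: max_def)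

text \<open>Jensen's inequality for the law with density proportional to \<open>exp X\<close> on \<open>S\<close>.\<close>

lemma cond_cgf_halve:
  assumes "Ent M (\<lambda>x. exp (max (X x) 0)) \<le> ereal (h * (\<integral>x. exp (X x) * indicator S x \<partial>M))"
  shows "V \<le> 2 * cond_cgf (\<lambda>x. X x / 2) + h"
proof -
  interpret half: exceedance M "\<lambda>x. X x / 2" by (rule exceedance_half)
  define T where "T = (\<integral>x. exp (max (X x) 0) * max (X x) 0 \<partial>M)"
  define t where "t = (V + h) / 2"
  have half_S: "half.S = S" by auto
  have "(1 - prob S + prob S * exp V) * ln (1 - prob S + prob S * exp V) \<le>
      prob S * exp V * ln (exp V)"
    using two_point_entropy_variational[of "prob S" 1 1 "exp V"] by simp
  then have "T \<le> prob S * exp V * (V + h)"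
    using assms unfolding entropy_le_iff T_def[symmetric] by (simp add: algebra_simps)
  then have "prob S * exp V \<le> (1 + t) * (prob S * exp V) - 1 / 2 * T"
    by (simp add: t_def field_simps)
  then have "exp (- t) * (prob S * exp V) \<le> exp (- t) * ((1 + t) * (prob S * exp V) - 1 / 2 * T)"
    by (intro mult_left_mono) auto
  also have "\<dots> = (\<integral>x. exp (- t) * ((1 + t) * (exp (X x) * indicator S x) -
      1 / 2 * (exp (max (X x) 0) * max (X x) 0)) \<partial>M)"
    using integrable_exp_S integrable_exp_pos_part(2) by (simp add: T_def integral_exp_S)
  also have "\<dots> \<le> (\<integral>x. exp (X x / 2) * indicator S x \<partial>M)"
    using integrable_exp_S integrable_exp_pos_part(2) half.integrable_exp_S[unfolded half_S]
    by (intro integral_mono cond_cgf_halve_tilted) auto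
  also have "\<dots> = prob S * exp (cond_cgf (\<lambda>x. X x / 2))"
    using half.integral_exp_S by (simp add: half_S)
  finally have "exp (V - t) \<le> exp (cond_cgf (\<lambda>x. X x / 2))"
    using prob_pos by (simp add: exp_diff exp_minus field_simps)
  then show ?thesis by (simp add: t_def field_simps)
qed

lemma prob_exceedance_le:
  assumes "0 \<le> r"
  shows "prob {x. r < X x} \<le> prob S * exp (V - r)"
proof -
  have "exp r * prob {x. r < X x} = (\<integral>x. exp r * indicator {x. r < X x} x \<partial>M)" by simp
  also have "\<dots> \<le> (\<integral>x. exp (X x) * indicator S x \<partial>M)"
  proof (rule integral_mono[OF _ integrable_exp_S])
    show "integrable M (\<lambda>x. exp r * indicator {x. r < X x} x)" by (simp add: emeasure_eq_measure)
  qed (use assms in \<open>auto simp: indicator_def\<close>)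
  finally show ?thesis by (simp add: integral_exp_S exp_diff field_simps)
qed

end

section \<open>Tail bounds and the transport map\<close>

context young_cost
begin

definition growth_const :: real where
  "growth_const = A / (1 - 2 powr (1 - \<alpha>))"

lemma dyadic_ratio: "0 < 2 powr (1 - \<alpha>)" "2 powr (1 - \<alpha>) < (1 :: real)"
  using powr_less_mono[of "1 - \<alpha>" 0 "2::real"] alpha_gt by auto

lemma growth_const_ge_1: "1 \<le> growth_const"
proof -
  have "1 - 2 powr (1 - \<alpha>) \<le> A" using dyadic_ratio(1) A_ge by linarith
  then show ?thesis using dyadic_ratio(2) by (simp add: growth_const_def le_divide_eq)
qed

lemma dyadic_H_le: "2 ^ j * H (y / 2 ^ j) \<le> A * H y * (2 powr (1 - \<alpha>)) ^ j"
proof -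
  have "H (1 / 2 ^ j * y) \<le> A * (1 / 2 ^ j) powr \<alpha> * H y"
    by (rule H_growth) auto
  then have "2 ^ j * H (y / 2 ^ j) \<le> 2 ^ j * (A * (1 / 2 ^ j) powr \<alpha> * H y)"
    by (intro mult_left_mono) auto
  also have "\<dots> = A * H y * (2 ^ j * (1 / 2 ^ j) powr \<alpha>)" by simp
  also have "2 ^ j * (1 / 2 ^ j) powr \<alpha> = (2 powr (1 - \<alpha>)) ^ j"
  proof -
    have "(2::real) ^ j = 2 powr real j" by (simp add: powr_realpow)
    moreover have "(1 / 2 ^ j) powr \<alpha> = (2::real) powr (- real j * \<alpha>)"
      by (simp add: powr_powr powr_minus_divide powr_divide flip: powr_realpow)
    moreover have "(2 powr (1 - \<alpha>)) ^ j = 2 powr ((1 - \<alpha>) * real j)"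
      by (simp add: powr_powr flip: powr_realpow)
    ultimately show ?thesis by (simp add: algebra_simps flip: powr_add)
  qed
  finally show ?thesis .
qed

lemma doubling_iterate:
  fixes W :: "real \<Rightarrow> real"
  assumes doubling: "\<And>y. 0 < y \<Longrightarrow> W y \<le> 2 * W (y / 2) + H y" and y: "0 < y"
  shows "W y \<le> 2 ^ n * W (y / 2 ^ n) + growth_const * H y"
proof -
  define q where "q = (2 :: real) powr (1 - \<alpha>)"
  have q: "0 < q" "q < 1" using dyadic_ratio by (auto simp: q_def)
  have "W y \<le> 2 ^ n * W (y / 2 ^ n) + (\<Sum>j<n. 2 ^ j * H (y / 2 ^ j))"
  proof (induction n)
    case (Suc n)
    have "2 ^ n * W (y / 2 ^ n) \<le> 2 ^ n * (2 * W (y / 2 ^ n / 2) + H (y / 2 ^ n))"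
      using doubling[of "y / 2 ^ n"] y by (intro mult_left_mono) auto
    then show ?case using Suc by (simp add: algebra_simps)
  qed simp
  also have "(\<Sum>j<n. 2 ^ j * H (y / 2 ^ j)) \<le> (\<Sum>j<n. A * H y * q ^ j)"
    unfolding q_def by (intro sum_mono dyadic_H_le)
  also have "\<dots> = A * H y * (\<Sum>j<n. q ^ j)" by (simp add: sum_distrib_left)
  also have "\<dots> \<le> A * H y * (1 / (1 - q))"
  proof (intro mult_left_mono)
    have "(\<Sum>j<n. q ^ j) = (1 - q ^ n) / (1 - q)" using q by (simp add: sum_gp_strict)
    then show "(\<Sum>j<n. q ^ j) \<le> 1 / (1 - q)" using q by (simp add: divide_right_mono)
  qed (use A_ge H_nonneg in auto)
  also have "\<dots> = growth_const * H y" by (simp add: growth_const_def q_def)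
  finally show ?thesis by simp
qed

lemma doubling_bound:
  fixes W :: "real \<Rightarrow> real"
  assumes doubling: "\<And>y. 0 < y \<Longrightarrow> W y \<le> 2 * W (y / 2) + H y"
    and small: "\<And>y. 0 < y \<Longrightarrow> y \<le> y0 \<Longrightarrow> W y \<le> K"
    and y0: "0 < y0" and K: "0 \<le> K" and y: "0 < y"
  shows "W y \<le> K + 2 * K / y0 * y + growth_const * H y"
proof -
  obtain n where "y / y0 < 2 ^ n" using real_arch_pow[of 2 "y / y0"] by auto
  then have ex: "\<exists>n. y \<le> y0 * 2 ^ n" using y0 by (auto simp: field_simps intro!: exI[of _ n])
  define n where "n = (LEAST n. y \<le> y0 * 2 ^ n)"
  have n: "y \<le> y0 * 2 ^ n" unfolding n_def using ex by (rule LeastI_ex)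
  have "2 ^ n \<le> 1 + 2 / y0 * y"
  proof (cases n)
    case (Suc m)
    then have "\<not> y \<le> y0 * 2 ^ m"
      using not_less_Least[of m "\<lambda>n. y \<le> y0 * 2 ^ n"] by (simp add: n_def)
    then show ?thesis using y0 Suc by (simp add: field_simps)
  qed (use y0 y in simp)
  then have "2 ^ n * K \<le> (1 + 2 / y0 * y) * K" using K by (intro mult_right_mono)
  moreover have "2 ^ n * W (y / 2 ^ n) \<le> 2 ^ n * K"
    using small[of "y / 2 ^ n"] n y by (intro mult_left_mono) (auto simp: field_simps)
  moreover have "(1 + 2 / y0 * y) * K = K + 2 * K / y0 * y" by (simp add: algebra_simps)
  ultimately show ?thesis using doubling_iterate[OF doubling y, of n] by linarith
qed

definition small_scale :: real where
  "small_scale = min (2 * t0) (4 / 5)"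

lemma small_scale_pos: "0 < small_scale"
  using t0_pos by (simp add: small_scale_def)

lemma H_small_scale:
  assumes "0 < y" "y \<le> small_scale"
  shows "H y \<le> 1 / 6"
proof -
  have "H y = y\<^sup>2 / 4" using assms by (intro H_quad) (auto simp: small_scale_def)
  also have "\<dots> \<le> (4 / 5)\<^sup>2 / 4"
    using assms by (intro divide_right_mono power_mono) (auto simp: small_scale_def)
  finally show ?thesis by (simp add: power2_eq_square)
qed

definition cgf_slope :: real where
  "cgf_slope = 2 * ln 6 / small_scale"

lemma cgf_slope_nonneg: "0 \<le> cgf_slope"
  using small_scale_pos by (simp add: cgf_slope_def)

end

locale log_sobolev_tail = log_sobolev_law +
  fixes s u :: real
  assumes abs_s: "\<bar>s\<bar> = 1"
    and tail_pos: "0 < prob {x. u < s * x}"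
    and tail_le_half: "prob {x. u < s * x} \<le> 1 / 2"
begin

definition excess :: "real \<Rightarrow> real \<Rightarrow> real" where
  "excess y x = y / c * s * x - y / c * u"

lemma less_excess_iff:
  assumes "0 < y"
  shows "y * r < excess y x \<longleftrightarrow> u + c * r < s * x"
proof -
  have "excess y x = y * ((s * x - u) / c)"
    by (simp add: excess_def right_diff_distrib diff_divide_distrib)
  then have "y * r < excess y x \<longleftrightarrow> r < (s * x - u) / c"
    using mult_less_cancel_left_pos[OF assms] by metis
  also have "\<dots> \<longleftrightarrow> u + c * r < s * x" using c_pos by (auto simp: pos_less_divide_eq mult.commute)
  finally show ?thesis .
qed

lemma excess_pos_iff: "0 < y \<Longrightarrow> 0 < excess y x \<longleftrightarrow> u < s * x"
  using less_excess_iff[of y 0] by simp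

lemma exceedance_excess:
  assumes "0 < y"
  shows "exceedance M (excess y)"
proof
  have "\<bar>2 * max (excess y x) 0\<bar> \<le> 2 * \<bar>y / c * u\<bar> + (2 * \<bar>y / c * s\<bar>) * \<bar>x\<bar>" for x
    using abs_affine_le[of "y / c * s" x "y / c * u"] unfolding excess_def
    by (cases "0 \<le> y / c * s * x - y / c * u") auto
  then show "integrable M (\<lambda>x. exp (2 * max (excess y x) 0))"
    by (intro integrable_exp_linear_growth(1)[OF exponential_moments]) (simp add: excess_def)
  show "excess y \<in> borel_measurable borel" unfolding excess_def [abs_def] by measurable
  show "0 < prob {x. 0 < excess y x}" using tail_pos by (simp add: excess_pos_iff[OF assms])
qed

lemma Ent_excess_le:
  assumes "0 < y"
  shows "Ent M (\<lambda>x. exp (max (excess y x) 0)) \<le>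
    ereal (H y * (\<integral>x. exp (excess y x) * indicator {x. 0 < excess y x} x \<partial>M))"
proof -
  have "H (c * (y / c * s)) = H \<bar>y * s\<bar>" using c_pos by simp
  also have "\<dots> = H y" using abs_s by (simp add: abs_mult)
  finally show ?thesis
    using Ent_hinge_le[of "y / c * s" "y / c * u"] by (simp add: excess_def)
qed

lemma cond_cgf_excess_le:
  assumes "0 < y"
  shows "cond_cgf (excess y) \<le> ln 6 + cgf_slope * y + growth_const * H y"
  unfolding cgf_slope_def
proof (rule doubling_bound[OF _ _ small_scale_pos _ assms])
  fix y :: real assume y: "0 < y"
  interpret exceedance M "excess y" by (rule exceedance_excess[OF y])
  have "(\<lambda>x. excess y x / 2) = excess (y / 2)" by (auto simp: excess_def diff_divide_distrib)
  then show "cond_cgf (excess y) \<le> 2 * cond_cgf (excess (y / 2)) + H y"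
    using cond_cgf_halve[OF Ent_excess_le[OF y]] by simp
  show "cond_cgf (excess y) \<le> ln 6" if "y \<le> small_scale"
    using cond_cgf_le_ln_6[OF Ent_excess_le[OF y] H_small_scale[OF y that]] tail_le_half
    by (simp add: excess_pos_iff[OF y])
qed simp

lemma prob_tail_le:
  assumes x: "0 \<le> x"
  shows "prob {z. u + c * (cgf_slope + growth_const * x) < s * z} \<le>
    6 * prob {z. u < s * z} * exp (- \<theta> x)"
    (is "?P \<le> 6 * ?p * _")
proof (rule chernoff_legendre[OF _ _ x])
  define r where "r = cgf_slope + growth_const * x"
  have r: "0 \<le> r" using cgf_slope_nonneg growth_const_ge_1 x by (simp add: r_def)
  then have "0 \<le> c * r" using c_pos by simp
  then have P_le: "?P \<le> ?p" unfolding r_def by (intro finite_measure_mono) auto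
  then show "?P \<le> 6 * ?p" using measure_nonneg[of M "{z. u < s * z}"] by linarith
  fix y :: real assume y: "0 < y"
  interpret exceedance M "excess y" by (rule exceedance_excess[OF y])
  show "?P \<le> 6 * ?p * exp (- (x * y - H y))"
  proof (cases "0 \<le> x * y - H y")
    case True
    have "cond_cgf (excess y) - y * r \<le> ln 6 - growth_const * (x * y - H y)"
      using cond_cgf_excess_le[OF y] by (simp add: r_def algebra_simps)
    also have "\<dots> \<le> ln 6 - 1 * (x * y - H y)"
      using True growth_const_ge_1 by (intro diff_left_mono mult_right_mono) auto
    finally have cgf_le: "cond_cgf (excess y) - y * r \<le> ln 6 - (x * y - H y)" by simp
    have "?P \<le> ?p * exp (cond_cgf (excess y) - y * r)"
      using prob_exceedance_le[of "y * r"] y r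
      by (simp add: less_excess_iff[OF y] excess_pos_iff[OF y] r_def)
    also have "\<dots> \<le> ?p * exp (ln 6 - (x * y - H y))" using cgf_le by (intro mult_left_mono) auto
    also have "\<dots> = 6 * ?p * exp (- (x * y - H y))" by (simp add: exp_diff exp_minus divide_inverse)
    finally show ?thesis .
  next
    case False
    then have "?p * 1 \<le> 6 * ?p * exp (- (x * y - H y))" by (intro mult_mono) auto
    then show ?thesis using P_le by linarith
  qed
qed simp

end

context log_sobolev_law
begin

definition spread :: "real \<Rightarrow> real" where
  "spread h = c * (cgf_slope + growth_const * dual.H_inv (h + ln 12))"

lemma spread_mono: "0 \<le> h \<Longrightarrow> h \<le> h' \<Longrightarrow> spread h \<le> spread h'"
  unfolding spread_def using c_pos growth_const_ge_1
  by (intro mult_left_mono add_left_mono dual.H_inv_mono) auto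

lemma spread_nonneg: "0 \<le> h \<Longrightarrow> 0 \<le> spread h"
  unfolding spread_def using c_pos growth_const_ge_1 cgf_slope_nonneg
  by (intro mult_nonneg_nonneg add_nonneg_nonneg dual.H_inv_nonneg) auto

lemma prob_spread_le:
  assumes s: "\<bar>s\<bar> = 1" and half: "prob {x. u < s * x} \<le> 1 / 2" and h: "0 \<le> h"
  shows "prob {x. u + spread h < s * x} \<le> prob {x. u < s * x} * exp (- h) / 2"
proof (cases "prob {x. u < s * x} = 0")
  case True
  have "prob {x. u + spread h < s * x} \<le> prob {x. u < s * x}"
    using spread_nonneg[OF h] by (intro finite_measure_mono) auto
  then show ?thesis using True by simp
next
  case False
  then have "0 < prob {x. u < s * x}" using measure_nonneg[of M] by (metis order_le_less)
  then interpret log_sobolev_tail H t0 A \<alpha> M c s u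
    using s half by unfold_locales
  have "prob {x. u + spread h < s * x} \<le>
      6 * prob {x. u < s * x} * exp (- \<theta> (dual.H_inv (h + ln 12)))"
    unfolding spread_def using h by (intro prob_tail_le dual.H_inv_nonneg) simp
  also have "\<theta> (dual.H_inv (h + ln 12)) = h + ln 12" using h by (intro dual.H_H_inv) simp
  also have "exp (- (h + ln 12)) = exp (- h) / 12" by (simp add: exp_diff exp_minus)
  finally show ?thesis by (simp add: mult.commute)
qed

lemma upper_tail_spread_le:
  assumes "prob {u<..} \<le> 1 / 2" "0 \<le> h"
  shows "prob {u + spread h<..} \<le> prob {u<..} * exp (- h) / 2"
proof -
  have "{x. v < 1 * x} = {v<..}" for v :: real by auto
  then show ?thesis using prob_spread_le[of 1 u h] assms by simp
qed

lemma lower_tail_spread_le: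
  assumes "prob {..<u} \<le> 1 / 2" "0 \<le> h"
  shows "prob {..<u - spread h} \<le> prob {..<u} * exp (- h) / 2"
proof -
  have "{x. - v < - 1 * x} = {..<v}" for v :: real by auto
  from this[of u] this[of "u - spread h"] show ?thesis
    using prob_spread_le[of "- 1" "- u" h] assms by simp
qed

lemma U_map_add_le:
  assumes x: "0 \<le> x" and h: "0 \<le> h"
  shows "U (x + h) \<le> U x + spread h"
proof (rule U_map_le_of_tail)
  have tail: "prob {U x<..} \<le> exp (- x) / 2" by (rule upper_tail_U_map[OF x])
  also have "\<dots> \<le> 1 / 2" using x by simp
  finally have "prob {U x + spread h<..} \<le> prob {U x<..} * exp (- h) / 2"
    by (rule upper_tail_spread_le[OF _ h])
  also have "\<dots> \<le> exp (- x) / 2 * exp (- h) / 2"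
    using tail by (intro divide_right_mono mult_right_mono) auto
  also have "\<dots> \<le> exp (- (x + h)) / 2" by (simp add: exp_diff exp_minus field_simps)
  finally show "prob {U x + spread h<..} \<le> exp (- (x + h)) / 2" .
qed (use assms in simp)

lemma U_map_diff_ge:
  assumes x: "x \<le> 0" and h: "0 \<le> h"
  shows "U x - spread h \<le> U (x - h)"
proof (rule U_map_ge_of_tail)
  have tail: "prob {..<U x} \<le> exp x / 2" by (rule lower_tail_U_map[OF x])
  also have "\<dots> \<le> 1 / 2" using x by simp
  finally have "prob {..<U x - spread h} \<le> prob {..<U x} * exp (- h) / 2"
    by (rule lower_tail_spread_le[OF _ h])
  also have "\<dots> \<le> exp x / 2 * exp (- h) / 2"
    using tail by (intro divide_right_mono mult_right_mono) auto
  also have "\<dots> < exp (x - h) / 2" by (simp add: exp_diff exp_minus field_simps)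
  finally show "prob {..<U x - spread h} < exp (x - h) / 2" .
qed (use assms in simp)

lemma U_map_increment_le:
  assumes h: "0 < h"
  shows "U (x + h) - U x \<le> 2 * spread h"
proof -
  consider (right) "0 \<le> x" | (left) "x + h \<le> 0" | (across) "x < 0" "0 < x + h" by linarith
  then show ?thesis
  proof cases
    case right
    then show ?thesis using U_map_add_le[of x h] spread_nonneg[of h] h by simp
  next
    case left
    then show ?thesis using U_map_diff_ge[of "x + h" h] spread_nonneg[of h] h by simp
  next
    case across
    have "U (0 + (x + h)) \<le> U 0 + spread (x + h)" using across by (intro U_map_add_le) auto
    moreover have "U 0 - spread (- x) \<le> U (0 - (- x))" using across by (intro U_map_diff_ge) auto
    moreover have "spread (x + h) \<le> spread h" "spread (- x) \<le> spread h"
      using across by (auto intro!: spread_mono)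
    ultimately show ?thesis by simp
  qed
qed

theorem transport_bound_of_log_sobolev: "\<exists>b. transport_bound H t0 A \<alpha> M b"
proof -
  have "0 \<le> 2 * c * cgf_slope" "0 < 2 * c * growth_const" "0 \<le> ln (12 :: real)"
    using c_pos cgf_slope_nonneg growth_const_ge_1 by auto
  from affine_legendre_inv_le_modulus[OF this] obtain b where b: "0 < b"
    and spread_le: "\<And>h. 0 \<le> h \<Longrightarrow>
      2 * c * cgf_slope + 2 * c * growth_const * dual.H_inv (h + ln 12) \<le> modulus h / b"
    by blast
  have "transport_bound H t0 A \<alpha> M b"
  proof
    fix h x :: real assume h: "0 < h"
    have "U (x + h) - U x \<le> 2 * spread h" by (rule U_map_increment_le[OF h])
    also have "\<dots> \<le> modulus h / b" using spread_le[of h] h by (simp add: spread_def algebra_simps)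
    finally show "U (x + h) - U x \<le> modulus h / b" .
  qed (rule b)
  then show ?thesis ..
qed

end

theorem (in cost_law) log_sobolev_iff_transport_bound:
  "exponential_moments M \<and> (\<exists>c>0. convex_log_sobolev M H c) \<longleftrightarrow> (\<exists>b. transport_bound H t0 A \<alpha> M b)"
proof (intro iffI; elim conjE exE)
  fix c assume "exponential_moments M" "0 < c" "convex_log_sobolev M H c"
  then interpret log_sobolev_law H t0 A \<alpha> M c by unfold_locales
  show "\<exists>b. transport_bound H t0 A \<alpha> M b" by (rule transport_bound_of_log_sobolev)
next
  fix b assume "transport_bound H t0 A \<alpha> M b"
  then interpret transport_bound H t0 A \<alpha> M b .
  show "exponential_moments M \<and> (\<exists>c>0. convex_log_sobolev M H c)"
    using exponential_moments_of_transport_bound convex_log_sobolev_of_transport_bound by blast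
qed

lemma (in cost_law) transport_bound_iff_Delta:
  "transport_bound H t0 A \<alpha> M b \<longleftrightarrow> 0 < b \<and> (\<forall>h>0. Delta M h \<le> ereal (modulus h / b))"
proof -
  have "transport_bound H t0 A \<alpha> M b \<longleftrightarrow> 0 < b \<and> (\<forall>h>0. \<forall>x. U (x + h) - U x \<le> modulus h / b)"
    using cost_law_axioms by (auto simp: transport_bound_def transport_bound_axioms_def)
  then show ?thesis by (simp add: Delta_def SUP_le_iff)
qed

theorem theorem1p1:
  fixes H :: "real \<Rightarrow> real" and t0 A \<alpha> :: real and \<mu> :: "real measure"
  assumes H_nonneg: "\<forall>x. 0 \<le> H x"
    and H_sym: "\<forall>x. H (- x) = H x"
    and H_convex: "convex_on UNIV H"
    and t0_pos: "t0 > 0"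
    and H_quad: "\<forall>x\<in>{-2*t0..2*t0}. H x = x\<^sup>2 / 4"
    and Hstar_superlin: "filterlim (\<lambda>x. legendre H x / x) at_top at_top"
    and A_ge: "A \<ge> 1"
    and alpha: "1 < \<alpha>" "\<alpha> \<le> 2"
    and H_growth: "\<forall>x. \<forall>s\<in>{0..1}. H (s * x) \<le> A * s powr \<alpha> * H x"
    and prob: "prob_space \<mu>"
    and borel: "sets \<mu> = sets borel"
  shows "((\<forall>s>0. integrable \<mu> (\<lambda>x. exp (s * \<bar>x\<bar>))) \<and>
          (\<exists>c>0. \<forall>\<phi> :: real \<Rightarrow> real. smooth \<phi> \<and> convex_on UNIV \<phi> \<and> (\<exists>L. L-lipschitz_on UNIV \<phi>) \<longrightarrow>
             Ent \<mu> (\<lambda>x. exp (\<phi> x)) \<le>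
               enn2ereal (\<integral>\<^sup>+ x. ennreal (H (c * deriv \<phi> x) * exp (\<phi> x)) \<partial>\<mu>)))
     \<longleftrightarrow>
         (\<exists>b>0. \<forall>h>0. Delta \<mu> h \<le> ereal (the_inv_into {0..} (legendre H) (t0\<^sup>2 + h) / b))"
proof -
  interpret prob_space \<mu> by (rule prob)
  have H_zero: "H 0 = 0" using bspec[OF H_quad, of 0] t0_pos by simp
  interpret cost_law H t0 A \<alpha> \<mu>
  proof
    show "H x = x\<^sup>2 / 4" if "\<bar>x\<bar> \<le> 2 * t0" for x
      using H_quad that by (auto simp: abs_le_iff)
    show "H (s * x) \<le> A * s powr \<alpha> * H x" if "0 \<le> s" "s \<le> 1" for s x
      using H_growth that by auto
  qed (use H_nonneg H_sym H_convex t0_pos A_ge alpha borel H_zero in auto)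
  show ?thesis
    using log_sobolev_iff_transport_bound
    unfolding transport_bound_iff_Delta exponential_moments_def convex_log_sobolev_def modulus_def .
qed

end
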